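(* Let $V$ be a simple unitary vertex operator algebra and let $U$ be a unitary subalgebra of $V$. Assume that $U$ is generated (as a vertex subalgebra) by $U_1=U\cap V_1$ together with a family of Hermitian quasi-primary Virasoro vectors and a family of Hermitian $\mathcal{W}_3$ vectors. Then $U$ is an energy-bounded unitary subalgebra of $V$.
   Context: A simple unitary vertex operator algebra is a vertex operator algebra $V$ (over $\mathbb{C}$) of CFT type, i.e. $V=\bigoplus_{n\geq 0}V_n$ with $V_n=\ker(L_0-n1_V)$ and $V_0=\mathbb{C}\Omega$, with vacuum $\Omega$ and conformal vector $\nu$, $Y(\nu,z)=\sum_{n}L_nz^{-n-2}$, equipped with a scalar product $(\cdot|\cdot)$ with $(\Omega|\Omega)=1$ and an antilinear involution $a\mapsto a^*$ with $\nu^*=\nu$ such that $(b|a_nc)=(a^*_{-n}b|c)$ for all $a,b,c\in V$, $n\in\mathbb{Z}$. For $a\in V$ the modes $a_n$ are defined by $Y(z^{L_0}a,z)=\sum_{n}a_nz^{-n}$. Write $\|a\|=\sqrt{(a|a)}$, $V_{\leq n}=\bigoplus_{k\leq n}V_k$, $\|R\|_n:=\sup\{\|Rb\|: b\in V_{\leq n},\|b\|\leq 1\}\in[0,\infty]$. A vector $a$ satisfies energy bounds if there are real $s,C,t\geq0$ with $\|a_m\|_n\leq C(1+|m|)^t(1+|n|)^s$ for all $m,n\in\mathbb{Z}$. A unitary subalgebra of $V$ is a vertex subalgebra $U$ (containing $\Omega$, closed under all products $a_{(n)}b$) with $L_0U\subset U$ and $U^*=U$; it is energy-bounded if every $a\in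 U$ satisfies energy bounds. A vector $a$ is Hermitian if $a^*=a$, quasi-primary if it is homogeneous and $L_1a=0$, primary if it is homogeneous and $L_ka=0$ for all $k>0$. A homogeneous $a$ is a Virasoro vector with central charge $\tilde c$ if $Y(a,z)=\sum_n\tilde L_nz^{-n-2}$ with $[\tilde L_m,\tilde L_n]=(m-n)\tilde L_{m+n}+\frac{\tilde c}{12}(m^3-m)\delta_{m,-n}1_V$. A Hermitian primary vector $\tilde\mu\in V_3$ is a Hermitian $\mathcal{W}_3$ vector with central charge $\tilde c\geq0$ if there is a Hermitian quasi-primary Virasoro vector $\tilde\nu$ with central charge $\tilde c$ such that, writing $Y(\tilde\mu,z)=\sum_n\tilde W_nz^{-n-3}$, $Y(\tilde\nu,z)=\sum_n\tilde L_nz^{-n-2}$, one has for all $m,n\in\mathbb{Z}$: $[\tilde W_m,\tilde W_n]=\frac{\tilde c}{3\cdot5!}(m^2-4)(m^2-1)m\,\delta_{m+n,0}1_V+b^2(m-n)\tilde\Lambda_{m+n}+\frac1{20}(m-n)(2m^2-mn+2n^2-8)\tilde L_{m+n}$, where $b^2=\frac{16}{22+5\tilde c}$ and $\tilde\Lambda_n:=(\tilde\nu_{-2}\tilde\nu-\frac3{10}\tilde\nu_{-1}\tilde\nu_{-1}\tilde\nu)_n$. *)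

theory Defs
  imports Complex_Main "HOL-Library.Groups_Big_Fun" "HOL-Library.Extended_Real"
begin

text \<open>A (candidate) unitary vertex operator algebra structure on the type 'v.
  sc: complex scalar multiplication; Y a n b = a_(n) b (the n-th product,
  Y(a,z) = sum_n a_(n) z^(-n-1)); vac = vacuum Omega; conf = conformal vector nu;
  ip = scalar product (antilinear in the first, linear in the second argument);
  star = the antilinear involution a |-> a*.\<close>
record 'v uvoa =
  sc   :: "complex \<Rightarrow> 'v \<Rightarrow> 'v"
  Y    :: "'v \<Rightarrow> int \<Rightarrow> 'v \<Rightarrow> 'v"
  vac  :: 'v
  conf :: 'v
  ip   :: "'v \<Rightarrow> 'v \<Rightarrow> complex"
  star :: "'v \<Rightarrow> 'v"

definition Lmode :: "('v::ab_group_add, 'z) uvoa_scheme \<Rightarrow> int \<Rightarrow> 'v \<Rightarrow> 'v" where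
  "Lmode V n = Y V (conf V) (n + 1)"

definition Vn :: "('v::ab_group_add, 'z) uvoa_scheme \<Rightarrow> int \<Rightarrow> 'v set" where
  "Vn V d = {v. Lmode V 0 v = sc V (of_int d) v}"

definition Vle :: "('v::ab_group_add, 'z) uvoa_scheme \<Rightarrow> int \<Rightarrow> 'v set" where
  "Vle V n = module.span (sc V) (\<Union>k\<in>{0..n}. Vn V k)"

definition homogeneous :: "('v::ab_group_add, 'z) uvoa_scheme \<Rightarrow> 'v \<Rightarrow> bool" where
  "homogeneous V a \<longleftrightarrow> (\<exists>d. a \<in> Vn V d)"

text \<open>The homogeneous component of a in V_d (unique by directness of the grading).\<close>
definition hcomp :: "('v::ab_group_add, 'z) uvoa_scheme \<Rightarrow> 'v \<Rightarrow> int \<Rightarrow> 'v" where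
  "hcomp V a d = (THE w. w \<in> Vn V d \<and>
     (\<exists>D f. finite D \<and> d \<notin> D \<and> (\<forall>k\<in>D. f k \<in> Vn V k) \<and> a = w + sum f D))"

text \<open>The modes a_n defined by Y(z^(L_0) a, z) = sum_n a_n z^(-n); for a in V_d,
  a_n = a_(n+d-1).\<close>
definition mode :: "('v::ab_group_add, 'z) uvoa_scheme \<Rightarrow> 'v \<Rightarrow> int \<Rightarrow> 'v \<Rightarrow> 'v" where
  "mode V a n = (\<lambda>b. sum (\<lambda>d. Y V (hcomp V a d) (n + d - 1) b) {d. hcomp V a d \<noteq> 0})"

definition vnorm :: "('v, 'z) uvoa_scheme \<Rightarrow> 'v \<Rightarrow> real" where
  "vnorm V a = sqrt (Re (ip V a a))"

definition restr_norm :: "('v::ab_group_add, 'z) uvoa_scheme \<Rightarrow> ('v \<Rightarrow> 'v) \<Rightarrow> int \<Rightarrow> ereal" where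
  "restr_norm V R n = (SUP b \<in> {b. b \<in> Vle V n \<and> vnorm V b \<le> 1}. ereal (vnorm V (R b)))"

definition vertex_subalgebra :: "('v::ab_group_add, 'z) uvoa_scheme \<Rightarrow> 'v set \<Rightarrow> bool" where
  "vertex_subalgebra V U \<longleftrightarrow> module.subspace (sc V) U \<and> vac V \<in> U \<and>
     (\<forall>a\<in>U. \<forall>b\<in>U. \<forall>n. Y V a n b \<in> U)"

definition generated_subalgebra :: "('v::ab_group_add, 'z) uvoa_scheme \<Rightarrow> 'v set \<Rightarrow> 'v set" where
  "generated_subalgebra V S = \<Inter> {W. vertex_subalgebra V W \<and> S \<subseteq> W}"

definition unitary_subalgebra :: "('v::ab_group_add, 'z) uvoa_scheme \<Rightarrow> 'v set \<Rightarrow> bool" where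
  "unitary_subalgebra V U \<longleftrightarrow> vertex_subalgebra V U \<and> Lmode V 0 ` U \<subseteq> U \<and> star V ` U = U"

definition energy_bounds :: "('v::ab_group_add, 'z) uvoa_scheme \<Rightarrow> 'v \<Rightarrow> bool" where
  "energy_bounds V a \<longleftrightarrow> (\<exists>s C t::real. s \<ge> 0 \<and> C \<ge> 0 \<and> t \<ge> 0 \<and>
     (\<forall>m n::int. restr_norm V (mode V a m) n \<le>
        ereal (C * (1 + real_of_int \<bar>m\<bar>) powr t * (1 + real_of_int \<bar>n\<bar>) powr s)))"

definition energy_bounded_subalgebra :: "('v::ab_group_add, 'z) uvoa_scheme \<Rightarrow> 'v set \<Rightarrow> bool" where
  "energy_bounded_subalgebra V U \<longleftrightarrow> unitary_subalgebra V U \<and> (\<forall>a\<in>U. energy_bounds V a)"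

definition hermitian :: "('v, 'z) uvoa_scheme \<Rightarrow> 'v \<Rightarrow> bool" where
  "hermitian V a \<longleftrightarrow> star V a = a"

definition quasi_primary :: "('v::ab_group_add, 'z) uvoa_scheme \<Rightarrow> 'v \<Rightarrow> bool" where
  "quasi_primary V a \<longleftrightarrow> homogeneous V a \<and> Lmode V 1 a = 0"

definition primary :: "('v::ab_group_add, 'z) uvoa_scheme \<Rightarrow> 'v \<Rightarrow> bool" where
  "primary V a \<longleftrightarrow> homogeneous V a \<and> (\<forall>k>0. Lmode V k a = 0)"

text \<open>Y(a,z) = sum_n Lt_n z^(-n-2), i.e. Lt_n = a_(n+1), satisfies the Virasoro relations
  with central charge c.\<close>
definition virasoro_vector :: "('v::ab_group_add, 'z) uvoa_scheme \<Rightarrow> 'v \<Rightarrow> complex \<Rightarrow> bool" where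
  "virasoro_vector V a c \<longleftrightarrow> homogeneous V a \<and>
     (\<forall>m n::int. \<forall>v. Y V a (m+1) (Y V a (n+1) v) - Y V a (n+1) (Y V a (m+1) v) =
        sc V (of_int (m - n)) (Y V a (m+n+1) v) +
        sc V (c / 12 * of_int (m^3 - m) * (if m = -n then 1 else 0)) v)"

definition W3_vector :: "('v::ab_group_add, 'z) uvoa_scheme \<Rightarrow> 'v \<Rightarrow> real \<Rightarrow> bool" where
  "W3_vector V \<mu> c \<longleftrightarrow> hermitian V \<mu> \<and> primary V \<mu> \<and> \<mu> \<in> Vn V 3 \<and> c \<ge> 0 \<and>
     (\<exists>\<nu>. hermitian V \<nu> \<and> quasi_primary V \<nu> \<and> virasoro_vector V \<nu> (complex_of_real c) \<and>
       (let Lt = (\<lambda>n. Y V \<nu> (n + 1));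
            Wt = (\<lambda>n. Y V \<mu> (n + 2));
            b2 = 16 / (22 + 5 * c);
            \<Lambda> = mode V \<nu> (-2) \<nu> - sc V (3/10) (mode V \<nu> (-1) (mode V \<nu> (-1) \<nu>));
            \<Lambda>t = (\<lambda>n. mode V \<Lambda> n)
        in \<forall>m n::int. \<forall>v. Wt m (Wt n v) - Wt n (Wt m v) =
             sc V (complex_of_real (c / (3 * 120) * real_of_int ((m^2 - 4) * (m^2 - 1) * m))
                     * (if m + n = 0 then 1 else 0)) v
           + sc V (complex_of_real (b2 * real_of_int (m - n))) (\<Lambda>t (m + n) v)
           + sc V (complex_of_real (1/20 * real_of_int ((m - n) * (2*m^2 - m*n + 2*n^2 - 8))))
                 (Lt (m + n) v)))"

definition simple_unitary_VOA :: "('v::ab_group_add, 'z) uvoa_scheme \<Rightarrow> bool" where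
  "simple_unitary_VOA V \<longleftrightarrow>
   \<comment> \<open>complex vector space\<close>
   vector_space (sc V) \<and>
   \<comment> \<open>bilinearity of the products\<close>
   (\<forall>n b. module_hom (sc V) (sc V) (\<lambda>a. Y V a n b)) \<and>
   (\<forall>n a. module_hom (sc V) (sc V) (Y V a n)) \<and>
   \<comment> \<open>truncation\<close>
   (\<forall>a b. \<exists>N. \<forall>n\<ge>N. Y V a n b = 0) \<and>
   \<comment> \<open>vacuum and creation\<close>
   (\<forall>n b. Y V (vac V) n b = (if n = -1 then b else 0)) \<and>
   (\<forall>a. Y V a (-1) (vac V) = a \<and> (\<forall>n\<ge>0. Y V a n (vac V) = 0)) \<and>
   \<comment> \<open>Borcherds (Jacobi) identity\<close>
   (\<forall>a b c p q r.
      Sum_any (\<lambda>i::nat. sc V ((of_int p :: complex) gchoose i) (Y V (Y V a (r + int i) b) (p + q - int i) c))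
    = Sum_any (\<lambda>i::nat. sc V ((-1)^i * ((of_int r :: complex) gchoose i))
          (Y V a (p + r - int i) (Y V b (q + int i) c)
           - sc V ((-1) powi r) (Y V b (q + r - int i) (Y V a (p + int i) c))))) \<and>
   \<comment> \<open>conformal vector: Virasoro relations with some central charge, L_{-1} = D\<close>
   (\<exists>c::complex. \<forall>m n::int. \<forall>v. Lmode V m (Lmode V n v) - Lmode V n (Lmode V m v) =
        sc V (of_int (m - n)) (Lmode V (m+n) v) +
        sc V (c / 12 * of_int (m^3 - m) * (if m = -n then 1 else 0)) v) \<and>
   (\<forall>a b n. Y V (Lmode V (-1) a) n b = sc V (- of_int n) (Y V a (n - 1) b)) \<and>
   \<comment> \<open>grading by L_0, CFT type, finite-dimensional homogeneous subspaces\<close>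
   (\<forall>a. \<exists>D f. finite D \<and> D \<subseteq> {0..} \<and> (\<forall>d\<in>D. f d \<in> Vn V d) \<and> a = sum f D) \<and>
   Vn V 0 = {sc V z (vac V) | z. True} \<and>
   (\<forall>d. \<exists>B. finite B \<and> B \<subseteq> Vn V d \<and> Vn V d \<subseteq> module.span (sc V) B) \<and>
   \<comment> \<open>simplicity: no nontrivial ideals\<close>
   (\<forall>I. module.subspace (sc V) I \<and> (\<forall>a v n. v \<in> I \<longrightarrow> Y V a n v \<in> I \<and> Y V v n a \<in> I)
        \<longrightarrow> I = {0} \<or> I = UNIV) \<and>
   \<comment> \<open>scalar product: sesquilinear, Hermitian, positive definite, normalized\<close>
   (\<forall>a. module_hom (sc V) (\<lambda>z w. z * w) (ip V a)) \<and>
   (\<forall>a b. ip V a b = cnj (ip V b a)) \<and>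
   (\<forall>a. a \<noteq> 0 \<longrightarrow> Im (ip V a a) = 0 \<and> Re (ip V a a) > 0) \<and>
   ip V (vac V) (vac V) = 1 \<and>
   \<comment> \<open>antilinear involution\<close>
   (\<forall>a b. star V (a + b) = star V a + star V b) \<and>
   (\<forall>z a. star V (sc V z a) = sc V (cnj z) (star V a)) \<and>
   (\<forall>a. star V (star V a) = a) \<and>
   star V (conf V) = conf V \<and>
   \<comment> \<open>invariance\<close>
   (\<forall>a b c n. ip V b (mode V a n c) = ip V (mode V (star V a) (-n) b) c)"

end

(*
  The vectors satisfying polynomial bounds on all their modes have homogeneous components
  forming a vertex subalgebra, because the Borcherds identity writes the modes of a_(N) b as
  sums of products a_(N-i) b_(k+i) and b_(k+N-i) a_(i) whose number of nonzero terms grows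
  linearly in the energy. So it suffices to bound the generators.

  For a Hermitian vector a, let A = a_m and B = a_(-m) with m > 0; they are adjoint to each other,
  and A lowers the energy by m. Hence |Ac|^2 <= |c| |BAc|, while |Be|^2 = |Ae|^2 + (e|[A,B]e) for
  e = Ac of energy n - m. Induction on the energy turns a polynomial bound on [a_m, a_(-m)] into
  one on a_m and a_(-m). For a in V_d quasi-primary, the zero mode follows from
  [L_1, a_(-1)] = d a_0.

  For currents the commutator [a_m, a_(-m)] is a scalar, and for W_3 vectors it is a combination
  of modes of vectors already controlled. For a Virasoro vector it involves the zero mode, but
  2 a_0 equals both [a_1, a_(-1)] and [L_1, a_(-1)]. Hence
  |a_(-1)e|^2 - |a_1 e|^2 = (L_(-1)e|a_(-1)e) - (a_1 e|L_1 e) <= 2(n+1)|e| (|a_(-1)e| + |a_1 e|),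
  that is |a_(-1)e| <= |a_1 e| + 2(n+1)|e|, which is enough to bound a_1, a_(-1) and then a_0 by
  induction on the energy n.
*)
theory Submission
  imports Defs
begin

subsection \<open>Elementary consequences of the axioms\<close>

lemma Sum_any_eq_sum: "finite A \<Longrightarrow> (\<And>i. i \<notin> A \<Longrightarrow> f i = 0) \<Longrightarrow> Sum_any f = sum f A"
  by (rule Sum_any.expand_superset) auto

locale uvoa =
  fixes V :: "('v::ab_group_add) uvoa"
  assumes VOA: "simple_unitary_VOA V"
begin

sublocale vs: vector_space "sc V"
  using VOA unfolding simple_unitary_VOA_def by (elim conjE)

lemma Y_hom1 [rule_format]: "\<forall>n b. module_hom (sc V) (sc V) (\<lambda>a. Y V a n b)"
  using VOA unfolding simple_unitary_VOA_def by (elim conjE)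

lemma Y_hom2 [rule_format]: "\<forall>n a. module_hom (sc V) (sc V) (Y V a n)"
  using VOA unfolding simple_unitary_VOA_def by (elim conjE)

lemma ip_hom [rule_format]: "\<forall>a. module_hom (sc V) (\<lambda>z w. z * w) (ip V a)"
  using VOA unfolding simple_unitary_VOA_def by (elim conjE)

lemma Y_vac [rule_format]: "\<forall>n b. Y V (vac V) n b = (if n = -1 then b else 0)"
  using VOA unfolding simple_unitary_VOA_def by (elim conjE)

lemma creation: "\<forall>a. Y V a (-1) (vac V) = a \<and> (\<forall>n\<ge>0. Y V a n (vac V) = 0)"
  using VOA unfolding simple_unitary_VOA_def by (elim conjE)

lemma Y_creation: "Y V a (-1) (vac V) = a" "n \<ge> 0 \<Longrightarrow> Y V a n (vac V) = 0"
  using creation by auto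

lemma borcherds [rule_format]:
  "\<forall>a b c p q r. Sum_any (\<lambda>i::nat. sc V ((of_int p :: complex) gchoose i) (Y V (Y V a (r + int i) b) (p + q - int i) c))
    = Sum_any (\<lambda>i::nat. sc V ((-1)^i * ((of_int r :: complex) gchoose i))
          (Y V a (p + r - int i) (Y V b (q + int i) c)
           - sc V ((-1) powi r) (Y V b (q + r - int i) (Y V a (p + int i) c))))"
  using VOA unfolding simple_unitary_VOA_def by (elim conjE)

lemma conf_virasoro:
  "\<exists>c::complex. \<forall>m n::int. \<forall>v. Lmode V m (Lmode V n v) - Lmode V n (Lmode V m v) =
        sc V (of_int (m - n)) (Lmode V (m+n) v) +
        sc V (c / 12 * of_int (m^3 - m) * (if m = -n then 1 else 0)) v"
  using VOA unfolding simple_unitary_VOA_def by (elim conjE)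

lemma translation [rule_format]: "\<forall>a b n. Y V (Lmode V (-1) a) n b = sc V (- of_int n) (Y V a (n - 1) b)"
  using VOA unfolding simple_unitary_VOA_def by (elim conjE)

lemma grading [rule_format]: "\<forall>a. \<exists>D f. finite D \<and> D \<subseteq> {0..} \<and> (\<forall>d\<in>D. f d \<in> Vn V d) \<and> a = sum f D"
  using VOA unfolding simple_unitary_VOA_def by (elim conjE)

lemma V0: "Vn V 0 = {sc V z (vac V) | z. True}"
  using VOA unfolding simple_unitary_VOA_def by (elim conjE)

lemma ip_cnj [rule_format]: "\<forall>a b. ip V a b = cnj (ip V b a)"
  using VOA unfolding simple_unitary_VOA_def by (elim conjE)

lemma ip_pos [rule_format]: "\<forall>a. a \<noteq> 0 \<longrightarrow> Im (ip V a a) = 0 \<and> Re (ip V a a) > 0"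
  using VOA unfolding simple_unitary_VOA_def by (elim conjE)

lemma ip_vac: "ip V (vac V) (vac V) = 1"
  using VOA unfolding simple_unitary_VOA_def by (elim conjE)

lemma star_add [rule_format]: "\<forall>a b. star V (a + b) = star V a + star V b"
  using VOA unfolding simple_unitary_VOA_def by (elim conjE)

lemma star_sc [rule_format]: "\<forall>z a. star V (sc V z a) = sc V (cnj z) (star V a)"
  using VOA unfolding simple_unitary_VOA_def by (elim conjE)

lemma star_star [rule_format]: "\<forall>a. star V (star V a) = a"
  using VOA unfolding simple_unitary_VOA_def by (elim conjE)

lemma star_conf: "star V (conf V) = conf V"
  using VOA unfolding simple_unitary_VOA_def by (elim conjE)

lemma invariance [rule_format]: "\<forall>a b c n. ip V b (mode V a n c) = ip V (mode V (star V a) (-n) b) c"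
  using VOA unfolding simple_unitary_VOA_def by (elim conjE)

lemmas Y_add1 = module_hom.add[OF Y_hom1]
  and Y_add2 = module_hom.add[OF Y_hom2]
  and Y_sc1 = module_hom.scale[OF Y_hom1]
  and Y_sc2 = module_hom.scale[OF Y_hom2]
  and Y_sum1 = module_hom.sum[OF Y_hom1]
  and Y_sum2 = module_hom.sum[OF Y_hom2]

lemma Y_0 [simp]: "Y V 0 n b = 0" "Y V a n 0 = 0"
  using module_hom.zero[OF Y_hom1] module_hom.zero[OF Y_hom2] by auto

section \<open>The norm of the scalar product: Cauchy-Schwarz and the triangle inequality\<close>

lemmas ip_add2 = module_hom.add[OF ip_hom]
  and ip_sc2 = module_hom.scale[OF ip_hom]
  and ip_diff2 = module_hom.diff[OF ip_hom]
  and ip_sum2 = module_hom.sum[OF ip_hom]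

lemma ip_0 [simp]: "ip V a 0 = 0" "ip V 0 a = 0"
  using module_hom.zero[OF ip_hom] ip_cnj[of 0 a] by auto

lemma ip_add1: "ip V (a + b) c = ip V a c + ip V b c"
  by (metis ip_add2 ip_cnj complex_cnj_add)

lemma ip_sc1: "ip V (sc V z a) c = cnj z * ip V a c"
  by (metis ip_sc2 ip_cnj complex_cnj_mult)

lemma ip_diff1: "ip V (a - b) c = ip V a c - ip V b c"
  by (metis ip_diff2 ip_cnj complex_cnj_diff)

lemma ip_self: "ip V a a = of_real ((vnorm V a)\<^sup>2)"
proof (cases "a = 0")
  case False
  then show ?thesis using ip_pos[OF False] by (simp add: vnorm_def complex_eq_iff)
qed (simp add: vnorm_def)

lemma vnorm_0 [simp]: "vnorm V 0 = 0"
  by (simp add: vnorm_def)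

lemma vnorm_pos: "a \<noteq> 0 \<Longrightarrow> vnorm V a > 0"
  using ip_pos[of a] by (simp add: vnorm_def)

lemma vnorm_nonneg [simp]: "vnorm V a \<ge> 0"
  using vnorm_pos[of a] by (cases "a = 0") auto

lemma ip_self_eq_0: "ip V a a = 0 \<Longrightarrow> a = 0"
  using ip_pos[of a] by auto

lemma vnorm_sc: "vnorm V (sc V z a) = cmod z * vnorm V a"
proof -
  have "ip V (sc V z a) (sc V z a) = of_real ((cmod z)\<^sup>2) * ip V a a"
    unfolding complex_norm_square ip_sc1 ip_sc2 by (simp only: mult_ac)
  then have "Re (ip V (sc V z a) (sc V z a)) = (cmod z)\<^sup>2 * Re (ip V a a)"
    by (simp only: Re_complex_of_real times_complex.sel Im_complex_of_real)
  then show ?thesis by (simp add: vnorm_def real_sqrt_mult)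
qed

lemma vnorm_minus: "vnorm V (- a) = vnorm V a"
  using vnorm_sc[of "-1" a] by simp

lemma cauchy_schwarz: "cmod (ip V a b) \<le> vnorm V a * vnorm V b"
proof (cases "a = 0")
  case False
  define z where "z = ip V a b / ip V a a"
  have na: "vnorm V a > 0" using False by (rule vnorm_pos)
  have "ip V (b - sc V z a) (b - sc V z a)
      = ip V b b - z * ip V b a - cnj z * ip V a b + cnj z * z * ip V a a"
    by (simp add: ip_diff1 ip_diff2 ip_sc1 ip_sc2 algebra_simps)
  also have "\<dots> = ip V b b - z * ip V b a"
    using na by (simp add: z_def)
  also have "z * ip V b a = of_real ((cmod (ip V a b))\<^sup>2 / (vnorm V a)\<^sup>2)"
    unfolding of_real_divide complex_norm_square z_def ip_cnj[of b a] ip_self by simp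
  finally have "complex_of_real ((vnorm V (b - sc V z a))\<^sup>2)
      = of_real ((vnorm V b)\<^sup>2 - (cmod (ip V a b))\<^sup>2 / (vnorm V a)\<^sup>2)"
    by (simp add: ip_self)
  then have "(vnorm V b)\<^sup>2 - (cmod (ip V a b))\<^sup>2 / (vnorm V a)\<^sup>2 \<ge> 0"
    by (metis of_real_eq_iff zero_le_power2)
  then have "(cmod (ip V a b))\<^sup>2 \<le> (vnorm V a * vnorm V b)\<^sup>2"
    using na by (simp add: field_simps power_mult_distrib)
  then show ?thesis by (rule power2_le_imp_le) simp
qed simp

lemma vnorm_add: "vnorm V (a + b) \<le> vnorm V a + vnorm V b"
proof -
  have "(vnorm V (a + b))\<^sup>2 = Re (ip V (a + b) (a + b))"
    unfolding ip_self by simp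
  also have "\<dots> = (vnorm V a)\<^sup>2 + (vnorm V b)\<^sup>2 + Re (ip V a b) + Re (ip V b a)"
    unfolding ip_add1 ip_add2 plus_complex.sel unfolding ip_self by simp
  also have "\<dots> \<le> (vnorm V a)\<^sup>2 + (vnorm V b)\<^sup>2 + vnorm V a * vnorm V b + vnorm V b * vnorm V a"
    using cauchy_schwarz[of a b] cauchy_schwarz[of b a] complex_Re_le_cmod[of "ip V a b"]
      complex_Re_le_cmod[of "ip V b a"] by linarith
  also have "\<dots> = (vnorm V a + vnorm V b)\<^sup>2"
    by (simp add: power2_eq_square algebra_simps)
  finally show ?thesis by (rule power2_le_imp_le) simp
qed

lemma vnorm_add3: "vnorm V (a + b + c) \<le> vnorm V a + (vnorm V b + vnorm V c)"
  using vnorm_add[of "a + b" c] vnorm_add[of a b] by linarith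

lemma vnorm_diff: "vnorm V (a - b) \<le> vnorm V a + vnorm V b"
  using vnorm_add[of a "-b"] by (simp add: vnorm_minus)

lemma vnorm_sum: "vnorm V (sum f A) \<le> (\<Sum>x\<in>A. vnorm V (f x))"
proof (induction A rule: infinite_finite_induct)
  case (insert x A)
  then show ?case using vnorm_add[of "f x" "sum f A"] by simp
qed auto

section \<open>The L_0-eigenspaces, and commutators with L_0, L_1 and L_(-1)\<close>

lemma subspace_Vn: "vs.subspace (Vn V d)"
  unfolding vs.subspace_def Vn_def Lmode_def mem_Collect_eq
  by (intro conjI ballI allI) (simp_all add: Y_add2 Y_sc2 vs.scale_right_distrib mult.commute)

lemmas Vn_add = vs.subspace_add[OF subspace_Vn]
  and Vn_sc = vs.subspace_scale[OF subspace_Vn]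
  and Vn_diff = vs.subspace_diff[OF subspace_Vn]
  and Vn_0 [simp] = vs.subspace_0[OF subspace_Vn]

lemma Vn_inter: "a \<in> Vn V d \<Longrightarrow> a \<in> Vn V e \<Longrightarrow> d \<noteq> e \<Longrightarrow> a = 0"
proof -
  assume "a \<in> Vn V d" "a \<in> Vn V e" "d \<noteq> e"
  then have "sc V (of_int d) a = sc V (of_int e) a"
    by (simp add: Vn_def)
  then show "a = 0"
    using \<open>d \<noteq> e\<close> vs.scale_cancel_right by (metis of_int_eq_iff)
qed

text \<open>The case r = 0 of the Borcherds identity: on the right, 0 choose i kills all terms but i
  = 0. The left sum stops at \<open>K\<close> either because p is a small natural number or because
  a_(i) b vanishes; both cases occur below.\<close>

lemma commutator:
  assumes "\<And>i. i > K \<Longrightarrow> of_int p gchoose i = (0::complex) \<or> Y V a (int i) b = 0"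
  shows "Y V a p (Y V b q c) - Y V b q (Y V a p c) =
    (\<Sum>i\<le>K. sc V ((of_int p :: complex) gchoose i) (Y V (Y V a (int i) b) (p + q - int i) c))"
proof -
  have "Sum_any (\<lambda>i::nat. sc V ((of_int p :: complex) gchoose i) (Y V (Y V a (0 + int i) b) (p + q - int i) c))
     = (\<Sum>i\<le>K. sc V ((of_int p :: complex) gchoose i) (Y V (Y V a (int i) b) (p + q - int i) c))"
    (is "Sum_any ?f = _")
  proof -
    have "?f i = 0" if "i \<notin> {..K}" for i
      using assms[OF that[unfolded atMost_iff not_le]] by (elim disjE) (simp_all only: add_0 Y_0 vs.scale_zero_left vs.scale_zero_right)
    then show ?thesis
      by (subst Sum_any_eq_sum[of "{..K}"]) simp_all
  qed
  moreover have "Sum_any (\<lambda>i::nat. sc V ((-1)^i * ((of_int 0 :: complex) gchoose i))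
          (Y V a (p + 0 - int i) (Y V b (q + int i) c)
           - sc V ((-1) powi 0) (Y V b (q + 0 - int i) (Y V a (p + int i) c))))
     = Y V a p (Y V b q c) - Y V b q (Y V a p c)"
    (is "Sum_any ?f = _")
  proof -
    have "?f i = 0" if "i \<notin> {0}" for i
      using that by (cases i) simp_all
    then show ?thesis
      by (subst Sum_any_eq_sum[of "{0}"]) simp_all
  qed
  ultimately show ?thesis using borcherds[where r=0 and p=p and q=q and a=a and b=b and c=c] by simp
qed

lemma gchoose_nat_eq_0: "n < i \<Longrightarrow> (of_int (int n) :: complex) gchoose i = 0"
  by (metis binomial_eq_0 binomial_gbinomial of_int_of_nat_eq of_nat_0)

text \<open>L_0 is the product \<nu>_(1), so only i = 0, 1 survive in \<open>commutator\<close>. The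
  term i = 0 is a mode of L_(-1) b, which \<open>translation\<close> turns into the scalar
  multiple.\<close>

lemma L0_comm:
  "Lmode V 0 (Y V b q c) - Y V b q (Lmode V 0 c)
     = sc V (- of_int (1 + q)) (Y V b q c) + Y V (Lmode V 0 b) q c"
proof -
  have "of_int 1 gchoose i = (0::complex) \<or> Y V (conf V) (int i) b = 0" if "1 < i" for i
    using gchoose_nat_eq_0[of 1 i] that by simp
  from commutator[of 1 1 "conf V" b q c, OF this] show ?thesis
    using translation[of b "1+q" c] by (simp add: Lmode_def)
qed

text \<open>Now L_1 = \<nu>_(2), and the terms i = 0, 1, 2 involve L_(-1) b, L_0 b and L_1 b. For
  quasi-primary b the last term drops out and a multiple of a single mode of b remains; zero modes
  are reached in this way later.\<close>

lemma L1_comm: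
  "Lmode V 1 (Y V b q c) - Y V b q (Lmode V 1 c)
     = sc V (- of_int (2 + q)) (Y V b (q + 1) c) + sc V 2 (Y V (Lmode V 0 b) (q + 1) c) + Y V (Lmode V 1 b) q c"
proof -
  have "of_int 2 gchoose i = (0::complex) \<or> Y V (conf V) (int i) b = 0" if "2 < i" for i
    using gchoose_nat_eq_0[of 2 i] that by simp
  from commutator[of 2 2 "conf V" b q c, OF this] show ?thesis
    using translation[of b "2+q" c]
    using binomial_gbinomial[of 2 2, where 'a = complex, symmetric]
    by (simp add: Lmode_def numeral_2_eq_2 add.commute)
qed

lemma Lm1_comm:
  "Lmode V (-1) (Y V b q c) - Y V b q (Lmode V (-1) c) = sc V (- of_int q) (Y V b (q - 1) c)"
proof -
  have "of_int 0 gchoose i = (0::complex) \<or> Y V (conf V) (int i) b = 0" if "0 < i" for i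
    using gchoose_nat_eq_0[of 0 i] that by simp
  from commutator[of 0 0 "conf V" b q c, OF this] show ?thesis
    using translation[of b q c] by (simp add: Lmode_def)
qed

lemma Y_Vn:
  assumes "b \<in> Vn V d" "c \<in> Vn V n" "k = n + d - 1 - q"
  shows "Y V b q c \<in> Vn V k"
proof -
  have b: "Lmode V 0 b = sc V (of_int d) b" and c: "Lmode V 0 c = sc V (of_int n) c"
    using assms by (auto simp: Vn_def)
  have "Lmode V 0 (Y V b q c) = sc V (- of_int (1 + q)) (Y V b q c) + Y V (Lmode V 0 b) q c + Y V b q (Lmode V 0 c)"
    using L0_comm[of b q c] by (simp add: algebra_simps)
  also have "\<dots> = sc V (of_int k) (Y V b q c)"
    unfolding b c assms(3) Y_sc1 Y_sc2 vs.scale_left_distrib[symmetric] by (simp add: algebra_simps)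
  finally show ?thesis by (simp add: Vn_def)
qed

text \<open>Apply [L_0, L_(-2)] = 2 L_(-2) to the vacuum: the creation axiom gives L_0 \<Omega> = 0
  and L_(-2) \<Omega> = \<nu>.\<close>

lemma conf_V2: "conf V \<in> Vn V 2"
proof -
  obtain c where c: "\<And>m n v. Lmode V m (Lmode V n v) - Lmode V n (Lmode V m v) =
        sc V (of_int (m - n)) (Lmode V (m+n) v) +
        sc V (c / 12 * of_int (m^3 - m) * (if m = -n then 1 else 0)) v"
    using conf_virasoro by blast
  from c[of 0 "-2" "vac V"] show ?thesis
    by (simp add: Lmode_def Vn_def Y_creation)
qed

lemma vac_V0: "vac V \<in> Vn V 0"
  unfolding V0 by (intro CollectI exI[of _ 1]) simp


subsection \<open>Homogeneous components and adjoints\<close>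

lemma Vn_independent:
  "finite D \<Longrightarrow> (\<And>k. k \<in> D \<Longrightarrow> f k \<in> Vn V k) \<Longrightarrow> sum f D = 0 \<Longrightarrow> k \<in> D \<Longrightarrow> f k = 0"
proof (induction D arbitrary: f k rule: finite_induct)
  case (insert x D)
  \<comment> \<open>L_0 - x kills the summand of degree x and multiplies the one of degree k by k -
    x, which is nonzero for k in \<open>D\<close>. The induction hypothesis is applied to
    \<open>g\<close>.\<close>
  define g where "g = (\<lambda>k. sc V (of_int (k - x)) (f k))"
  have "Lmode V 0 (sum f (insert x D)) = (\<Sum>k\<in>insert x D. sc V (of_int k) (f k))"
    unfolding Lmode_def Y_sum2 using insert.prems(1)
    by (intro sum.cong refl) (auto simp: Vn_def Lmode_def)
  then have "(\<Sum>k\<in>insert x D. sc V (of_int k) (f k)) - sc V (of_int x) (sum f (insert x D)) = 0"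
    using insert.prems(2) by (simp add: Lmode_def)
  then have "sum g (insert x D) = 0"
    by (simp only: g_def vs.scale_sum_right sum_subtractf of_int_diff vs.scale_left_diff_distrib)
  then have "sum g D = 0"
    using insert.hyps by (simp add: g_def)
  then have "g k = 0" if "k \<in> D" for k
    using insert.IH[of g k] insert.prems(1) that by (auto simp: g_def intro: Vn_sc)
  then have D: "f k = 0" if "k \<in> D" for k
    using that insert.hyps by (auto simp: g_def)
  then have "f x = 0"
    using insert.prems(2) insert.hyps by simp
  then show ?case
    using D insert.prems(3) by auto
qed simp

lemma hcomp_sum_Vn:
  assumes D: "finite D" "\<And>k. k \<in> D \<Longrightarrow> f k \<in> Vn V k"
  shows "hcomp V (sum f D) d = (if d \<in> D then f d else 0)"
  unfolding hcomp_def
proof (rule the_equality, goal_cases)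
  case 1
  have "sum f D = (if d \<in> D then f d else 0) + sum f (D - {d})"
    using D(1) by (simp add: sum.remove)
  then show ?case
    using D by (intro conjI exI[of _ "D - {d}"] exI[of _ f]) auto
next
  case (2 w)
  then obtain E g where w: "w \<in> Vn V d" and E: "finite E" "d \<notin> E" "\<forall>k\<in>E. g k \<in> Vn V k"
    and eq: "sum f D = w + sum g E" by blast
  \<comment> \<open>The difference of the given decomposition and the competing one, extended by
    zero to a common index set; independence of the eigenspaces forces its entry at d to
    vanish.\<close>
  define h where "h k = (if k \<in> D then f k else 0) - (if k = d then w else if k \<in> E then g k else 0)" for k
  let ?T = "insert d (D \<union> E)"
  have "(\<Sum>k\<in>?T. if k \<in> D then f k else 0) = sum f D"
    using D E by (intro sum.mono_neutral_cong_right) auto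
  moreover have "(\<Sum>k\<in>?T. if k = d then w else if k \<in> E then g k else 0)
      = (\<Sum>k\<in>insert d E. if k = d then w else if k \<in> E then g k else 0)"
    using D E by (intro sum.mono_neutral_cong_right) auto
  moreover have "\<dots> = w + sum g E"
    using E by (subst sum.insert) (auto intro!: sum.cong arg_cong2[of _ _ _ _ "(+)"])
  ultimately have "sum h ?T = 0"
    unfolding h_def sum_subtractf using eq by simp
  then have "h d = 0"
    using D E w by (intro Vn_independent[of ?T h d]) (auto simp: h_def intro!: Vn_diff vs.subspace_neg[OF subspace_Vn])
  then show ?case by (simp add: h_def)
qed

text \<open>The family is extended by zero outside \<open>D\<close>, so that the next lemma can
  identify it with the function \<open>hcomp V a\<close>.\<close>

lemma decomposition: "\<exists>D f. finite D \<and> D \<subseteq> {0..} \<and> (\<forall>k. f k \<in> Vn V k) \<and> (\<forall>k. k \<notin> D \<longrightarrow> f k = 0) \<and> a = sum f D"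
proof -
  obtain D f where "finite D" "D \<subseteq> {0..}" "\<forall>d\<in>D. f d \<in> Vn V d" "a = sum f D"
    using grading[of a] by (elim exE conjE)
  then show ?thesis
    by (intro exI[of _ D] exI[of _ "\<lambda>k. if k \<in> D then f k else 0"]) auto
qed

lemma hcomp_decomposition:
  obtains D where "finite D" "D \<subseteq> {0..}" "\<And>k. k \<notin> D \<Longrightarrow> hcomp V a k = 0"
    "a = sum (hcomp V a) D" "\<And>k. hcomp V a k \<in> Vn V k"
proof -
  obtain D f where D: "finite D" "D \<subseteq> {0..}" "\<forall>k. f k \<in> Vn V k" "\<forall>k. k \<notin> D \<longrightarrow> f k = 0" "a = sum f D"
    using decomposition[of a] by (elim exE conjE)
  have "hcomp V a k = f k" for k
    unfolding D(5) using D(1,3,4) by (subst hcomp_sum_Vn) simp_all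
  then have "hcomp V a = f" ..
  then show thesis
    using D by (intro that[of D]) simp_all
qed

lemma hcomp_in [simp]: "hcomp V a d \<in> Vn V d"
  by (rule hcomp_decomposition[of a])

lemma finite_hcomp: "finite {d. hcomp V a d \<noteq> 0}"
proof (rule hcomp_decomposition[of a])
  fix D assume D: "finite D" "\<And>k. k \<notin> D \<Longrightarrow> hcomp V a k = 0"
  then have "{d. hcomp V a d \<noteq> 0} \<subseteq> D" by blast
  with D(1) show ?thesis by (rule finite_subset[rotated])
qed

lemma sum_hcomp: "a = (\<Sum>d | hcomp V a d \<noteq> 0. hcomp V a d)"
proof (rule hcomp_decomposition[of a])
  fix D assume D: "finite D" "\<And>k. k \<notin> D \<Longrightarrow> hcomp V a k = 0" "a = sum (hcomp V a) D"
  have "sum (hcomp V a) D = (\<Sum>d | hcomp V a d \<noteq> 0. hcomp V a d)"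
    by (rule sum.mono_neutral_right) (use D(1,2) in auto)
  with D(3) show ?thesis by (rule trans)
qed

lemma sum_hcomp_superset:
  assumes "finite E" "{d. hcomp V a d \<noteq> 0} \<subseteq> E"
  shows "a = sum (hcomp V a) E"
  by (rule trans[OF sum_hcomp sum.mono_neutral_left]) (use assms in auto)

lemma hcomp_Vn: "a \<in> Vn V d \<Longrightarrow> hcomp V a k = (if k = d then a else 0)"
  using hcomp_sum_Vn[of "{d}" "\<lambda>_. a" k] by simp

lemma hcomp_0 [simp]: "hcomp V 0 k = 0"
  using hcomp_Vn[of 0 k] by simp

lemma hcomp_add: "hcomp V (a + b) d = hcomp V a d + hcomp V b d"
proof -
  let ?E = "{d. hcomp V a d \<noteq> 0} \<union> {d. hcomp V b d \<noteq> 0}"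
  have "a + b = (\<Sum>d\<in>?E. hcomp V a d + hcomp V b d)"
    unfolding sum.distrib using finite_hcomp
    by (intro arg_cong2[of _ _ _ _ "(+)"] sum_hcomp_superset) auto
  then have "hcomp V (a + b) d = hcomp V (\<Sum>d\<in>?E. hcomp V a d + hcomp V b d) d"
    by (rule arg_cong)
  also have "\<dots> = hcomp V a d + hcomp V b d"
    using finite_hcomp Vn_add[OF hcomp_in hcomp_in] by (subst hcomp_sum_Vn) auto
  finally show ?thesis .
qed

lemma hcomp_sc: "hcomp V (sc V z a) d = sc V z (hcomp V a d)"
proof -
  let ?E = "{d. hcomp V a d \<noteq> 0}"
  have "sc V z a = (\<Sum>d\<in>?E. sc V z (hcomp V a d))"
    using arg_cong[OF sum_hcomp[of a], of "sc V z"] by (simp only: vs.scale_sum_right)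
  then have "hcomp V (sc V z a) d = hcomp V (\<Sum>d\<in>?E. sc V z (hcomp V a d)) d"
    by (rule arg_cong)
  also have "\<dots> = sc V z (hcomp V a d)"
    using finite_hcomp Vn_sc[OF hcomp_in] by (subst hcomp_sum_Vn) auto
  finally show ?thesis .
qed

lemma hcomp_sum: "hcomp V (sum f A) d = (\<Sum>x\<in>A. hcomp V (f x) d)"
  by (induction A rule: infinite_finite_induct) (auto simp: hcomp_add)

text \<open>The grading axiom supplies only degrees at least 0, so a component of negative degree is
  0, while a homogeneous vector is its own component. The inductions on the energy start from this
  fact.\<close>

lemma Vn_neg:
  assumes "a \<in> Vn V d" "d < 0"
  shows "a = 0"
proof (rule hcomp_decomposition[of a])
  fix D :: "int set" assume "D \<subseteq> {0..}" "\<And>k. k \<notin> D \<Longrightarrow> hcomp V a k = 0"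
  then have "hcomp V a d = 0" using assms(2) by (meson atLeast_iff in_mono not_le)
  then show ?thesis using assms(1) by (simp add: hcomp_Vn)
qed

section \<open>Modes, adjoints and orthogonality of the grading\<close>

lemma mode_superset:
  assumes "finite E" "{d. hcomp V a d \<noteq> 0} \<subseteq> E"
  shows "mode V a n b = (\<Sum>d\<in>E. Y V (hcomp V a d) (n + d - 1) b)"
  unfolding mode_def by (rule sum.mono_neutral_left) (use assms in auto)

lemma mode_Vn: "a \<in> Vn V d \<Longrightarrow> mode V a n b = Y V a (n + d - 1) b"
  by (subst mode_superset[of "{d}"]) (auto simp: hcomp_Vn split: if_splits)

text \<open>The mode a_n is the product a_(n+d-1), so passing from n to -n reflects the product
  index about d - 1. This is the condition on i + j.\<close>

lemma adjoint:
  assumes "a \<in> Vn V d" "hermitian V a" "i + j = 2 * d - 2"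
  shows "ip V b (Y V a i c) = ip V (Y V a j b) c"
proof -
  have "j = - (i - d + 1) + d - 1" using assms by simp
  moreover have "star V a = a" using assms by (simp add: hermitian_def)
  ultimately show ?thesis
    using invariance[of b a "i - d + 1" c] by (simp add: mode_Vn[OF assms(1)])
qed

lemma adjoint_L: "ip V b (Lmode V n c) = ip V (Lmode V (- n) b) c"
  unfolding Lmode_def using conf_V2 star_conf by (intro adjoint) (auto simp: hermitian_def)

lemma orthogonal:
  assumes "a \<in> Vn V i" "b \<in> Vn V j" "i \<noteq> j"
  shows "ip V a b = 0"
proof -
  have "ip V a (Lmode V 0 b) = ip V (Lmode V 0 a) b"
    using adjoint_L[of a 0 b] by simp
  then have "(of_int j - of_int i) * ip V a b = 0"
    using assms by (simp add: Vn_def ip_sc1 ip_sc2 algebra_simps)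
  then show ?thesis using assms(3) by simp
qed

lemma L_Vn: "c \<in> Vn V n \<Longrightarrow> k = n - m \<Longrightarrow> Lmode V m c \<in> Vn V k"
  unfolding Lmode_def by (rule Y_Vn[OF conf_V2]) auto

subsection \<open>Bounds from commutators of adjoint operators\<close>

lemma norm_le_adjoint:
  assumes adj: "\<And>b c. ip V b (A c) = ip V (B b) c"
  shows "(vnorm V (A c))\<^sup>2 \<le> vnorm V (B (A c)) * vnorm V c"
proof -
  have "complex_of_real ((vnorm V (A c))\<^sup>2) = ip V (B (A c)) c"
    unfolding ip_self[symmetric] adj ..
  then have "(vnorm V (A c))\<^sup>2 = cmod (ip V (B (A c)) c)"
    by (metis norm_of_real abs_of_nonneg zero_le_power2)
  then show ?thesis using cauchy_schwarz[of "B (A c)" c] by simp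
qed

text \<open>The commutator term is kept exact here: \<open>raising_le_lowering\<close> estimates it
  by Cauchy-Schwarz, whereas for Virasoro vectors it is first rewritten as a commutator with
  L_1.\<close>

lemma norm_adjoint_commutator:
  assumes adj: "\<And>b c. ip V b (A c) = ip V (B b) c"
  shows "complex_of_real ((vnorm V (B c))\<^sup>2) = of_real ((vnorm V (A c))\<^sup>2) + ip V c (A (B c) - B (A c))"
proof -
  have "ip V (B c) (B c) = ip V c (A (B c))" by (simp add: adj)
  moreover have "ip V (A c) (A c) = ip V c (B (A c))"
    using adj[of "A c" c] ip_cnj[of "A c" "A c"] ip_cnj[of c "B (A c)"] by simp
  ultimately show ?thesis
    unfolding ip_self ip_diff2 by simp
qed

lemma raising_le_lowering:
  assumes adj: "\<And>b c. ip V b (A c) = ip V (B b) c"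
    and K: "vnorm V (A (B c) - B (A c)) \<le> K * vnorm V c"
  shows "(vnorm V (B c))\<^sup>2 \<le> (vnorm V (A c))\<^sup>2 + K * (vnorm V c)\<^sup>2"
proof -
  have "(vnorm V (B c))\<^sup>2 = (vnorm V (A c))\<^sup>2 + Re (ip V c (A (B c) - B (A c)))"
    using arg_cong[OF norm_adjoint_commutator[OF adj, of c], of Re]
    by (simp only: plus_complex.sel Re_complex_of_real)
  also have "Re (ip V c (A (B c) - B (A c))) \<le> vnorm V c * (K * vnorm V c)"
    using complex_Re_le_cmod[of "ip V c (A (B c) - B (A c))"] cauchy_schwarz[of c "A (B c) - B (A c)"]
      mult_left_mono[OF K, of "vnorm V c"] by simp
  finally show ?thesis by (simp add: power2_eq_square mult_ac)
qed

text \<open>Induction on the energy. The vector e = A c has energy n - m, so |A e|^2 is at most (n -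
  m) K |e|^2; the commutator adds K |e|^2, and m \<ge> 1 gives |B e|^2 \<le> n K |e|^2. With |e|^2
  \<le> |B e| |c| one factor |e|^2 cancels. The commutator bound is assumed for all energies up to
  N, so K stays fixed during the induction.\<close>

lemma lowering_bound:
  assumes adj: "\<And>b c. ip V b (A c) = ip V (B b) c"
    and deg: "\<And>n c. c \<in> Vn V n \<Longrightarrow> A c \<in> Vn V (n - m)" and m: "m > 0"
    and comm: "\<And>n c. n \<le> N \<Longrightarrow> c \<in> Vn V n \<Longrightarrow> vnorm V (A (B c) - B (A c)) \<le> K * vnorm V c"
    and K: "K \<ge> 0"
  shows "0 \<le> n \<Longrightarrow> n \<le> N \<Longrightarrow> c \<in> Vn V n \<Longrightarrow> (vnorm V (A c))\<^sup>2 \<le> real_of_int n * K * (vnorm V c)\<^sup>2"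
proof (induction "nat n" arbitrary: n c rule: less_induct)
  case less
  define e where "e = A c"
  have e: "e \<in> Vn V (n - m)" using deg less e_def by simp
  have "(vnorm V (B e))\<^sup>2 \<le> n * K * (vnorm V e)\<^sup>2"
  proof (cases "n - m < 0")
    case True
    then have "e = 0" using e Vn_neg by blast
    \<comment> \<open>Linearity of \<open>B\<close> is not among the assumptions; adjointness gives
      (B 0 | B 0) = (0 | A (B 0)) = 0.\<close>
    have "B 0 = 0"
      using adj[of 0 "B 0"] ip_self_eq_0[of "B 0"] by simp
    then show ?thesis using \<open>e = 0\<close> by simp
  next
    case False
    have "(vnorm V (A e))\<^sup>2 \<le> real_of_int (n - m) * K * (vnorm V e)\<^sup>2"
      using less.hyps[of "n - m" e] less.prems m e False by auto
    moreover have "(vnorm V (B e))\<^sup>2 \<le> (vnorm V (A e))\<^sup>2 + K * (vnorm V e)\<^sup>2"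
      using raising_le_lowering[OF adj comm[OF _ e]] less.prems m by auto
    ultimately have "(vnorm V (B e))\<^sup>2 \<le> real_of_int (n - m + 1) * (K * (vnorm V e)\<^sup>2)"
      by (simp add: algebra_simps)
    also have "\<dots> \<le> n * (K * (vnorm V e)\<^sup>2)"
      using m K by (intro mult_right_mono) auto
    finally show ?thesis by (simp add: mult.assoc)
  qed
  then have "((vnorm V (B e)) * vnorm V c)\<^sup>2 \<le> n * K * (vnorm V e)\<^sup>2 * (vnorm V c)\<^sup>2"
    by (simp add: power_mult_distrib mult_right_mono)
  moreover have "((vnorm V e)\<^sup>2)\<^sup>2 \<le> ((vnorm V (B e)) * vnorm V c)\<^sup>2"
    using norm_le_adjoint[OF adj, of c] by (intro power_mono) (auto simp: e_def)
  ultimately have "(vnorm V e)\<^sup>2 * (vnorm V e)\<^sup>2 \<le> (vnorm V e)\<^sup>2 * (n * K * (vnorm V c)\<^sup>2)"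
    by (simp add: power2_eq_square mult_ac)
  moreover have "0 \<le> n * K * (vnorm V c)\<^sup>2"
    using less.prems K by simp
  ultimately have "(vnorm V e)\<^sup>2 \<le> n * K * (vnorm V c)\<^sup>2"
    by (cases "vnorm V e = 0") (simp, metis mult_le_cancel_left_pos zero_less_power2)
  then show ?case by (simp add: e_def)
qed

text \<open>\<open>lowering_bound\<close> for the adjoint pair L_1, L_(-1). Their commutator is 2
  L_0, the scalar 2 l on V_l, since the central term carries the factor 1^3 - 1 = 0; so K = 2 n
  works for all energies up to n.\<close>

lemma L1_bound:
  assumes c: "c \<in> Vn V n" and n: "n \<ge> 0"
  shows "vnorm V (Lmode V 1 c) \<le> 2 * real_of_int n * vnorm V c"
    and "vnorm V (Lmode V (-1) c) \<le> 2 * (real_of_int n + 1) * vnorm V c"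
proof -
  have adj: "ip V b (Lmode V 1 c) = ip V (Lmode V (-1) b) c" for b c
    using adjoint_L[of b 1 c] by simp
  obtain z where z: "\<And>m n v. Lmode V m (Lmode V n v) - Lmode V n (Lmode V m v) =
        sc V (of_int (m - n)) (Lmode V (m+n) v) +
        sc V (z / 12 * of_int (m^3 - m) * (if m = -n then 1 else 0)) v"
    using conf_virasoro by blast
  have comm: "vnorm V (Lmode V 1 (Lmode V (-1) c) - Lmode V (-1) (Lmode V 1 c)) \<le> 2 * k * vnorm V c"
    if "l \<le> k" "c \<in> Vn V l" for k l c
  proof (cases "l < 0")
    case True
    then have "c = 0" using Vn_neg that by blast
    then show ?thesis by (simp add: Lmode_def)
  next
    case False
    have "Lmode V 1 (Lmode V (-1) c) - Lmode V (-1) (Lmode V 1 c) = sc V (2 * of_int l) c"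
      using z[of 1 "-1" c] that by (simp add: Vn_def)
    then show ?thesis using that False by (simp add: vnorm_sc norm_mult mult_right_mono)
  qed
  have "(vnorm V (Lmode V 1 c))\<^sup>2 \<le> real_of_int n * (2 * real_of_int n) * (vnorm V c)\<^sup>2"
    using n by (intro lowering_bound[OF adj L_Vn, where m = 1 and N = n] comm c) auto
  also have "\<dots> \<le> (2 * real_of_int n * vnorm V c)\<^sup>2"
    using n by (simp add: power_mult_distrib power2_eq_square)
  finally show *: "vnorm V (Lmode V 1 c) \<le> 2 * real_of_int n * vnorm V c"
    by (rule power2_le_imp_le) (use n in simp)
  have "(vnorm V (Lmode V (-1) c))\<^sup>2 \<le> (vnorm V (Lmode V 1 c))\<^sup>2 + 2 * real_of_int n * (vnorm V c)\<^sup>2"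
    using raising_le_lowering[OF adj comm] c by auto
  also have "\<dots> \<le> (2 * real_of_int n * vnorm V c)\<^sup>2 + 2 * real_of_int n * (vnorm V c)\<^sup>2"
    using * n by (intro add_mono power_mono) auto
  also have "\<dots> \<le> (2 * (real_of_int n + 1) * vnorm V c)\<^sup>2"
    using n by (simp add: power_mult_distrib power2_eq_square algebra_simps)
  finally show "vnorm V (Lmode V (-1) c) \<le> 2 * (real_of_int n + 1) * vnorm V c"
    by (rule power2_le_imp_le) (use n in simp)
qed

end

subsection \<open>Polynomially bounded vectors\<close>

text \<open>Polynomial growth in i of the coefficients in the product formula, for negative N too.
  With M = |N|, consecutive coefficients have ratio at most 1 + M/(1+i), which Bernoulli bounds by
  (1 + 1/(1+i))^M = ((2+i)/(1+i))^M; the product telescopes.\<close>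

lemma norm_gbinomial_int_le: "cmod (of_int N gchoose i) \<le> (1 + real i) ^ nat \<bar>N\<bar>"
proof (induction i)
  case (Suc i)
  let ?M = "nat \<bar>N\<bar>"
  have rec: "(of_int N :: complex) gchoose Suc i = (of_int N gchoose i) * (of_int (N - int i) / of_nat (Suc i))"
    by (simp add: gbinomial_prod_rev mult_ac)
  have "cmod (of_int (N - int i) :: complex) \<le> real ?M + real i"
    unfolding norm_of_int by linarith
  then have "cmod (of_int (N - int i) / of_nat (Suc i) :: complex) \<le> (real ?M + real i) / (1 + real i)"
    unfolding norm_divide norm_of_nat by (simp add: divide_right_mono)
  also have "\<dots> \<le> 1 + real ?M * (1 / (1 + real i))"
    by (simp add: field_simps)
  also have "\<dots> \<le> (1 + 1 / (1 + real i)) ^ ?M"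
    by (rule Bernoulli_inequality) (simp add: field_simps)
  finally have "cmod (of_int N gchoose Suc i) \<le> (1 + real i) ^ ?M * (1 + 1 / (1 + real i)) ^ ?M"
    unfolding rec norm_mult by (intro mult_mono Suc.IH) auto
  also have "\<dots> = ((1 + real i) * (1 + 1 / (1 + real i))) ^ ?M"
    by (rule power_mult_distrib[symmetric])
  also have "(1 + real i) * (1 + 1 / (1 + real i)) = 1 + real (Suc i)"
    by (simp add: distrib_left)
  finally show ?case .
qed simp

text \<open>Index and energy share one weight because products of modes mix them. Being at least 1,
  it absorbs additive constants and lets exponents be raised freely. The two variables are separated
  only in \<open>EB_energy_bounds\<close>.\<close>

definition wt :: "int \<Rightarrow> int \<Rightarrow> real" where
  "wt m n = 1 + real_of_int \<bar>m\<bar> + real_of_int \<bar>n\<bar>"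

lemma wt_ge_1: "wt m n \<ge> 1" and wt_pos [simp]: "wt m n > 0" and wt_nonneg [simp]: "wt m n \<ge> 0"
  by (auto simp: wt_def)

lemma wt_power_mono: "p \<le> q \<Longrightarrow> wt m n ^ p \<le> wt m n ^ q"
  by (rule power_increasing[OF _ wt_ge_1])

lemma wt_add_le:
  assumes "real_of_int \<bar>x\<bar> + real_of_int \<bar>y\<bar> \<le> wt m n + K" "K \<ge> 0"
  shows "wt x y \<le> (2 + K) * wt m n"
proof -
  have "K \<le> K * wt m n" using mult_left_mono[OF wt_ge_1 assms(2), of m n] by simp
  then show ?thesis using assms(1) wt_ge_1[of m n] unfolding wt_def[of x y] by (simp add: distrib_right)
qed

context uvoa
begin

text \<open>The bound uses the index of the \<open>k\<close>-th product, not the degree-shifted mode; by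
  \<open>eb_shiftI\<close> and \<open>eb_shiftE\<close> a fixed shift of the index is immaterial.\<close>

definition eb :: "'v \<Rightarrow> bool" where
  "eb a \<longleftrightarrow> (\<exists>C p. C \<ge> 0 \<and> (\<forall>k n. \<forall>c\<in>Vn V n. vnorm V (Y V a k c) \<le> C * wt k n ^ p * vnorm V c))"

lemma eb_shiftI:
  assumes "C \<ge> 0" "\<And>m n c. c \<in> Vn V n \<Longrightarrow> vnorm V (Y V a (m + e) c) \<le> C * wt m n ^ p * vnorm V c"
  shows "eb a"
  unfolding eb_def
proof (intro exI conjI allI ballI)
  show "C * (2 + real_of_int \<bar>e\<bar>) ^ p \<ge> 0" using assms(1) by simp
  fix k n c assume c: "c \<in> Vn V n"
  have "wt (k - e) n \<le> (2 + real_of_int \<bar>e\<bar>) * wt k n"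
    by (rule wt_add_le) (auto simp: wt_def)
  then have "wt (k - e) n ^ p \<le> (2 + real_of_int \<bar>e\<bar>) ^ p * wt k n ^ p"
    unfolding power_mult_distrib[symmetric] by (intro power_mono) auto
  then have "C * wt (k - e) n ^ p * vnorm V c \<le> C * ((2 + real_of_int \<bar>e\<bar>) ^ p * wt k n ^ p) * vnorm V c"
    using assms(1) by (intro mult_right_mono mult_left_mono) auto
  then show "vnorm V (Y V a k c) \<le> C * (2 + real_of_int \<bar>e\<bar>) ^ p * wt k n ^ p * vnorm V c"
    using assms(2)[OF c, of "k - e"] by (simp add: mult.assoc)
qed

lemma eb_shiftE:
  assumes "eb a"
  obtains C p where "C \<ge> 0" "\<And>m n c. c \<in> Vn V n \<Longrightarrow> vnorm V (Y V a (m + e) c) \<le> C * wt m n ^ p * vnorm V c"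
proof -
  obtain C p where C: "C \<ge> 0" "\<And>k n c. c \<in> Vn V n \<Longrightarrow> vnorm V (Y V a k c) \<le> C * wt k n ^ p * vnorm V c"
    using assms unfolding eb_def by blast
  show thesis
  proof (rule that)
    show "C * (2 + real_of_int \<bar>e\<bar>) ^ p \<ge> 0" using C(1) by simp
    fix m n c assume c: "c \<in> Vn V n"
    have "wt (m + e) n \<le> (2 + real_of_int \<bar>e\<bar>) * wt m n"
      by (rule wt_add_le) (auto simp: wt_def)
    then have "wt (m + e) n ^ p \<le> (2 + real_of_int \<bar>e\<bar>) ^ p * wt m n ^ p"
      unfolding power_mult_distrib[symmetric] by (intro power_mono) auto
    then have "C * wt (m + e) n ^ p * vnorm V c \<le> C * ((2 + real_of_int \<bar>e\<bar>) ^ p * wt m n ^ p) * vnorm V c"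
      using C(1) by (intro mult_right_mono mult_left_mono) auto
    then show "vnorm V (Y V a (m + e) c) \<le> C * (2 + real_of_int \<bar>e\<bar>) ^ p * wt m n ^ p * vnorm V c"
      using C(2)[OF c, of "m + e"] by (simp add: mult.assoc)
  qed
qed

section \<open>Closure of polynomial bounds under sums, scalars and n-th products\<close>

lemma eb_0 [simp]: "eb 0"
  by (rule eb_shiftI[of 0]) auto

text \<open>The exponent p + q serves as a common upper bound for p and q.\<close>

lemma wt_bound_sum:
  assumes "x \<le> C * wt m n ^ p * v" "y \<le> D * wt m n ^ q * v" "C \<ge> 0" "D \<ge> 0" "v \<ge> 0"
  shows "x + y \<le> (C + D) * wt m n ^ (p + q) * v"
proof -
  have "C * wt m n ^ p * v \<le> C * wt m n ^ (p + q) * v" "D * wt m n ^ q * v \<le> D * wt m n ^ (p + q) * v"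
    using assms by (auto intro!: mult_right_mono mult_left_mono wt_power_mono)
  then show ?thesis using assms(1,2) by (simp add: distrib_right)
qed

lemma eb_add:
  assumes "eb a" "eb b"
  shows "eb (a + b)"
proof -
  obtain C p where C: "C \<ge> 0" "\<And>m n c. c \<in> Vn V n \<Longrightarrow> vnorm V (Y V a (m + 0) c) \<le> C * wt m n ^ p * vnorm V c"
    using eb_shiftE[OF assms(1)] by blast
  obtain D q where D: "D \<ge> 0" "\<And>m n c. c \<in> Vn V n \<Longrightarrow> vnorm V (Y V b (m + 0) c) \<le> D * wt m n ^ q * vnorm V c"
    using eb_shiftE[OF assms(2)] by blast
  show ?thesis
  proof (rule eb_shiftI)
    show "C + D \<ge> 0" using C D by simp
    fix m n c assume c: "c \<in> Vn V n"
    show "vnorm V (Y V (a + b) (m + 0) c) \<le> (C + D) * wt m n ^ (p + q) * vnorm V c"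
      using wt_bound_sum[OF C(2)[OF c] D(2)[OF c] C(1) D(1) vnorm_nonneg, of m]
        vnorm_add[of "Y V a (m + 0) c" "Y V b (m + 0) c"] unfolding Y_add1 by linarith
  qed
qed

lemma eb_sc:
  assumes "eb a"
  shows "eb (sc V z a)"
proof -
  obtain C p where C: "C \<ge> 0" "\<And>m n c. c \<in> Vn V n \<Longrightarrow> vnorm V (Y V a (m + 0) c) \<le> C * wt m n ^ p * vnorm V c"
    using eb_shiftE[OF assms(1)] by blast
  show ?thesis
  proof (rule eb_shiftI)
    show "cmod z * C \<ge> 0" using C by simp
    fix m n c assume c: "c \<in> Vn V n"
    show "vnorm V (Y V (sc V z a) (m + 0) c) \<le> cmod z * C * wt m n ^ p * vnorm V c"
      unfolding Y_sc1 vnorm_sc using mult_left_mono[OF C(2)[OF c], of "cmod z" m] by (simp add: mult.assoc)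
  qed
qed

lemma eb_sum: "(\<And>x. x \<in> A \<Longrightarrow> eb (f x)) \<Longrightarrow> eb (sum f A)"
  by (induction A rule: infinite_finite_induct) (auto intro: eb_add)

lemma eb_vac: "eb (vac V)"
  by (rule eb_shiftI[of 1 _ 0 0]) (auto simp: Y_vac)

text \<open>The product would have negative degree. Unlike the truncation axiom, this names the
  threshold, which is linear in the energy; hence so is the number of terms in the product
  formula.\<close>

lemma Y_vanish:
  assumes "a \<in> Vn V d" "c \<in> Vn V n" "k \<ge> n + d"
  shows "Y V a k c = 0"
  by (rule Vn_neg[OF Y_Vn[OF assms(1,2) refl]]) (use assms(3) in simp)

text \<open>The Borcherds identity with p = 0, r = N, q = k: now the left side collapses to i = 0,
  and the hypotheses cut the right side at I.\<close>

lemma product_formula: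
  assumes "\<And>i. i \<ge> I \<Longrightarrow> Y V b (k + int i) c = 0" "\<And>i. i \<ge> I \<Longrightarrow> Y V a (int i) c = 0"
  shows "Y V (Y V a N b) k c = (\<Sum>i<I. sc V ((-1)^i * ((of_int N :: complex) gchoose i))
          (Y V a (N - int i) (Y V b (k + int i) c)
           - sc V ((-1) powi N) (Y V b (k + N - int i) (Y V a (int i) c))))"
proof -
  have lhs: "Sum_any (\<lambda>i::nat. sc V ((of_int 0 :: complex) gchoose i) (Y V (Y V a (N + int i) b) (0 + k - int i) c))
     = Y V (Y V a N b) k c" (is "Sum_any ?f = _")
  proof -
    have "?f i = 0" if "i \<notin> {0}" for i
      using that by (cases i) simp_all
    then show ?thesis
      by (subst Sum_any_eq_sum[of "{0}"]) simp_all
  qed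
  have rhs: "Sum_any (\<lambda>i::nat. sc V ((-1)^i * ((of_int N :: complex) gchoose i))
          (Y V a (0 + N - int i) (Y V b (k + int i) c)
           - sc V ((-1) powi N) (Y V b (k + N - int i) (Y V a (0 + int i) c))))
     = (\<Sum>i<I. sc V ((-1)^i * ((of_int N :: complex) gchoose i))
          (Y V a (N - int i) (Y V b (k + int i) c)
           - sc V ((-1) powi N) (Y V b (k + N - int i) (Y V a (int i) c))))"
    (is "Sum_any ?f = _")
  proof -
    have "?f i = 0" if "i \<notin> {..<I}" for i
    proof -
      from that have "i \<ge> I" by simp
      then show ?thesis by (simp only: add_0 assms Y_0 vs.scale_zero_right diff_self)
    qed
    then show ?thesis
      unfolding add_0 by (intro Sum_any_eq_sum) auto
  qed
  show ?thesis
    by (rule trans[OF trans[OF lhs[symmetric] borcherds] rhs])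
qed

text \<open>The index and energy pairs met in the product formula are linear in n and k. Here the
  variables stand for absolute values, so the inequalities are purely linear; the last one serves
  the binomial coefficient.\<close>

lemma index_bounds:
  fixes i n k d e N :: int
  assumes "i \<ge> 0" "i \<le> n + k + d + e" "n \<ge> 0" "k \<ge> 0" "d \<ge> 0" "e \<ge> 0" "N \<ge> 0"
  shows "N + i + (n + e + 1 + k + i) \<le> 3 * (1 + k + n) + (3 + N + 3 * d + 3 * e)"
    and "k + i + n \<le> 3 * (1 + k + n) + (3 + N + 3 * d + 3 * e)"
    and "k + N + i + (n + d + 1 + i) \<le> 3 * (1 + k + n) + (3 + N + 3 * d + 3 * e)"
    and "i + n \<le> 3 * (1 + k + n) + (3 + N + 3 * d + 3 * e)"
    and "i + 0 \<le> 3 * (1 + k + n) + (3 + N + 3 * d + 3 * e)"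
  unfolding distrib_left using assms by simp_all

lemma eb_product:
  assumes a: "a \<in> Vn V d" "eb a" and b: "b \<in> Vn V e" "eb b"
  shows "eb (Y V a N b)"
proof -
  obtain C p where C: "C \<ge> 0" "\<And>m n c. c \<in> Vn V n \<Longrightarrow> vnorm V (Y V a (m + 0) c) \<le> C * wt m n ^ p * vnorm V c"
    using eb_shiftE[OF a(2)] by blast
  obtain D q where D: "D \<ge> 0" "\<And>m n c. c \<in> Vn V n \<Longrightarrow> vnorm V (Y V b (m + 0) c) \<le> D * wt m n ^ q * vnorm V c"
    using eb_shiftE[OF b(2)] by blast
  define K where "K = real_of_int (3 + \<bar>N\<bar> + 3 * \<bar>d\<bar> + 3 * \<bar>e\<bar>)"
  \<comment> \<open>\<open>M\<close> is chosen so that every weight occurring in the product formula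
    is at most \<open>M * wt k n\<close>.\<close>
  define M where "M = 5 + K"
  define L where "L = nat \<bar>N\<bar>"
  have K: "K \<ge> 0" by (simp add: K_def)
  have wtM: "wt x y \<le> M * wt k n"
    if "\<bar>x\<bar> + \<bar>y\<bar> \<le> 3 * (1 + \<bar>k\<bar> + \<bar>n\<bar>) + (3 + \<bar>N\<bar> + 3 * \<bar>d\<bar> + 3 * \<bar>e\<bar>)" for x y k n
  proof -
    have "real_of_int (\<bar>x\<bar> + \<bar>y\<bar>) \<le> real_of_int (3 * (1 + \<bar>k\<bar> + \<bar>n\<bar>) + (3 + \<bar>N\<bar> + 3 * \<bar>d\<bar> + 3 * \<bar>e\<bar>))"
      using that of_int_le_iff by blast
    then have "real_of_int \<bar>x\<bar> + real_of_int \<bar>y\<bar> \<le> 3 * wt k n + K"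
      by (simp add: wt_def K_def)
    moreover have "K \<le> K * wt k n" using mult_left_mono[OF wt_ge_1 K, of k n] by simp
    ultimately show ?thesis
      using wt_ge_1[of k n] unfolding wt_def[of x y] M_def by (simp add: distrib_right)
  qed
  show ?thesis
  proof (rule eb_shiftI)
    \<comment> \<open>The exponent collects one power for the number of terms, \<open>L\<close> for
      the binomial coefficient, and p and q for the two modes; the 2 comes from the two products in
      each term.\<close>
    show "2 * (C * D) * M ^ (1 + L + p + q) \<ge> 0"
      using C D K by (simp add: M_def)
    fix k n c assume c: "c \<in> Vn V n"
    define X where "X = M * wt k n"
    \<comment> \<open>From this i on, \<open>Y_vanish\<close> kills both b_(k+i) c and a_(i)
      c.\<close>
    define I where "I = nat (1 + \<bar>n\<bar> + \<bar>k\<bar> + \<bar>d\<bar> + \<bar>e\<bar>)"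
    define T where "T i = sc V ((-1)^i * ((of_int N :: complex) gchoose i))
          (Y V a (N - int i) (Y V b (k + int i) c)
           - sc V ((-1) powi N) (Y V b (k + N - int i) (Y V a (int i) c)))" for i
    have X0: "X \<ge> 0" using K by (simp add: X_def M_def)
    have "Y V (Y V a N b) (k + 0) c = (\<Sum>i<I. T i)"
      unfolding T_def add_0_right
      by (rule product_formula; rule Y_vanish[OF _ c]) (use a b in \<open>auto simp: I_def\<close>)
    then have "vnorm V (Y V (Y V a N b) (k + 0) c) \<le> (\<Sum>i<I. vnorm V (T i))"
      using vnorm_sum by simp
    also have "\<dots> \<le> of_nat (card {..<I}) * (X ^ L * (2 * (C * D) * X ^ (p + q) * vnorm V c))"
    proof (rule sum_bounded_above)
      fix i assume i: "i \<in> {..<I}"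
      then have i': "int i \<le> \<bar>n\<bar> + \<bar>k\<bar> + \<bar>d\<bar> + \<bar>e\<bar>" by (simp add: I_def)
      have bc: "Y V b (k + int i) c \<in> Vn V (n + e - 1 - k - int i)"
        by (rule Y_Vn[OF b(1) c]) simp
      have ac: "Y V a (int i) c \<in> Vn V (n + d - 1 - int i)"
        by (rule Y_Vn[OF a(1) c]) simp
      \<comment> \<open>The first four are the weights of the modes, outer ones taken at the energy
        reached after the inner mode has acted. The fifth is 1 + i, the base in the binomial
        bound.\<close>
      have w: "wt (N - int i) (n + e - 1 - k - int i) \<le> X" "wt (k + int i) n \<le> X"
        "wt (k + N - int i) (n + d - 1 - int i) \<le> X" "wt (int i) n \<le> X" "wt (int i) 0 \<le> X"
        unfolding X_def
      proof -
        have "\<bar>N - int i\<bar> \<le> \<bar>N\<bar> + int i" "\<bar>k + int i\<bar> \<le> \<bar>k\<bar> + int i"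
          "\<bar>n + e - 1 - k - int i\<bar> \<le> \<bar>n\<bar> + \<bar>e\<bar> + 1 + \<bar>k\<bar> + int i"
          "\<bar>k + N - int i\<bar> \<le> \<bar>k\<bar> + \<bar>N\<bar> + int i"
          "\<bar>n + d - 1 - int i\<bar> \<le> \<bar>n\<bar> + \<bar>d\<bar> + 1 + int i"
          by linarith+
        note abs_bounds = this
        note lin = index_bounds[OF _ i' abs_ge_zero[of n] abs_ge_zero[of k] abs_ge_zero[of d] abs_ge_zero[of e] abs_ge_zero[of N]]
        show "wt (N - int i) (n + e - 1 - k - int i) \<le> M * wt k n"
          by (rule wtM, rule order.trans[OF add_mono[OF abs_bounds(1,3)]], rule lin(1), simp)
        show "wt (k + int i) n \<le> M * wt k n"
          by (rule wtM, rule order.trans[OF add_mono[OF abs_bounds(2) order.refl]], rule lin(2), simp)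
        show "wt (k + N - int i) (n + d - 1 - int i) \<le> M * wt k n"
          by (rule wtM, rule order.trans[OF add_mono[OF abs_bounds(4,5)]], rule lin(3), simp)
        show "wt (int i) n \<le> M * wt k n"
          by (rule wtM, unfold abs_of_nat, rule lin(4), simp)
        show "wt (int i) 0 \<le> M * wt k n"
          by (rule wtM, unfold abs_of_nat abs_0, rule lin(5), simp)
      qed
      have "vnorm V (Y V a (N - int i) (Y V b (k + int i) c))
          \<le> C * wt (N - int i) (n + e - 1 - k - int i) ^ p * vnorm V (Y V b (k + int i) c)"
        using C(2)[OF bc, of "N - int i"] by simp
      also have "\<dots> \<le> C * X ^ p * (D * X ^ q * vnorm V c)"
      proof (intro mult_mono power_mono w order.refl)
        show "vnorm V (Y V b (k + int i) c) \<le> D * X ^ q * vnorm V c"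
          using D(2)[OF c, of "k + int i"] D(1)
            mult_right_mono[OF mult_left_mono[OF power_mono[OF w(2), of q] D(1)] vnorm_nonneg[of c]]
          by simp
      qed (use C D X0 in auto)
      finally have 1: "vnorm V (Y V a (N - int i) (Y V b (k + int i) c)) \<le> C * D * X ^ (p + q) * vnorm V c"
        by (simp add: power_add mult_ac)
      have "vnorm V (Y V b (k + N - int i) (Y V a (int i) c))
          \<le> D * wt (k + N - int i) (n + d - 1 - int i) ^ q * vnorm V (Y V a (int i) c)"
        using D(2)[OF ac, of "k + N - int i"] by simp
      also have "\<dots> \<le> D * X ^ q * (C * X ^ p * vnorm V c)"
      proof (intro mult_mono power_mono w order.refl)
        show "vnorm V (Y V a (int i) c) \<le> C * X ^ p * vnorm V c"
          using C(2)[OF c, of "int i"] C(1)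
            mult_right_mono[OF mult_left_mono[OF power_mono[OF w(4), of p] C(1)] vnorm_nonneg[of c]]
          by simp
      qed (use C D X0 in auto)
      finally have 2: "vnorm V (Y V b (k + N - int i) (Y V a (int i) c)) \<le> C * D * X ^ (p + q) * vnorm V c"
        by (simp add: power_add mult_ac)
      have "cmod (of_int N gchoose i) \<le> (1 + real i) ^ L"
        unfolding L_def by (rule norm_gbinomial_int_le)
      also have "\<dots> \<le> X ^ L"
        using w(5) by (intro power_mono) (auto simp: wt_def)
      finally have 3: "cmod ((-1)^i * (of_int N gchoose i)) \<le> X ^ L"
        by (simp add: norm_mult norm_power)
      have "vnorm V (Y V a (N - int i) (Y V b (k + int i) c)
           - sc V ((-1) powi N) (Y V b (k + N - int i) (Y V a (int i) c)))
         \<le> vnorm V (Y V a (N - int i) (Y V b (k + int i) c))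
           + vnorm V (Y V b (k + N - int i) (Y V a (int i) c))"
        using vnorm_diff[of "Y V a (N - int i) (Y V b (k + int i) c)"
            "sc V ((-1) powi N) (Y V b (k + N - int i) (Y V a (int i) c))"]
        by (simp add: vnorm_sc norm_power_int)
      also have "\<dots> \<le> 2 * (C * D) * X ^ (p + q) * vnorm V c"
        using 1 2 by simp
      finally show "vnorm V (T i) \<le> X ^ L * (2 * (C * D) * X ^ (p + q) * vnorm V c)"
        unfolding T_def vnorm_sc using 3 X0 by (intro mult_mono) auto
    qed
    also have "of_nat (card {..<I}) = real I" by simp
    also have "real I * (X ^ L * (2 * (C * D) * X ^ (p + q) * vnorm V c))
        \<le> X * (X ^ L * (2 * (C * D) * X ^ (p + q) * vnorm V c))"
    proof (rule mult_right_mono)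
      have "wt (\<bar>n\<bar> + \<bar>k\<bar> + \<bar>d\<bar> + \<bar>e\<bar>) 0 \<le> X"
        unfolding X_def by (rule wtM) simp
      then show "real I \<le> X" by (simp add: I_def wt_def)
    qed (use X0 C D in auto)
    also have "\<dots> = 2 * (C * D) * M ^ (1 + L + p + q) * wt k n ^ (1 + L + p + q) * vnorm V c"
      unfolding X_def by (simp add: power_add power_mult_distrib mult_ac)
    finally show "vnorm V (Y V (Y V a N b) (k + 0) c)
      \<le> 2 * (C * D) * M ^ (1 + L + p + q) * wt k n ^ (1 + L + p + q) * vnorm V c" .
  qed
qed

text \<open>Bounds are imposed on each homogeneous component because \<open>eb_product\<close> takes
  homogeneous factors and the index shift in \<open>mode\<close> depends on the degree.\<close>

definition EB :: "'v set" where
  "EB = {a. \<forall>d. eb (hcomp V a d)}"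

lemma EB_Vn: "a \<in> Vn V d \<Longrightarrow> eb a \<Longrightarrow> a \<in> EB"
  by (simp add: EB_def hcomp_Vn)

text \<open>For products, expand both factors into components. Each resulting product is
  homogeneous, so its component of degree k is either itself or 0.\<close>

lemma vertex_subalgebra_EB: "vertex_subalgebra V EB"
  unfolding vertex_subalgebra_def
proof (intro conjI ballI allI)
  show "vs.subspace EB"
    unfolding vs.subspace_def EB_def by (auto simp: hcomp_add hcomp_sc intro: eb_add eb_sc)
  show "vac V \<in> EB"
    using EB_Vn[OF vac_V0 eb_vac] .
  fix a b n assume "a \<in> EB" "b \<in> EB"
  define A where "A = {d. hcomp V a d \<noteq> 0}"
  define B where "B = {d. hcomp V b d \<noteq> 0}"
  have "Y V a n b = Y V (sum (hcomp V a) A) n (sum (hcomp V b) B)"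
    unfolding A_def B_def by (intro arg_cong2[of _ _ _ _ "\<lambda>a b. Y V a n b"] sum_hcomp)
  also have "\<dots> = (\<Sum>d\<in>A. \<Sum>e\<in>B. Y V (hcomp V a d) n (hcomp V b e))"
    unfolding Y_sum1 unfolding Y_sum2 ..
  finally have "hcomp V (Y V a n b) k = (\<Sum>d\<in>A. \<Sum>e\<in>B. hcomp V (Y V (hcomp V a d) n (hcomp V b e)) k)" for k
    by (simp add: hcomp_sum)
  moreover have "eb (hcomp V (Y V (hcomp V a d) n (hcomp V b e)) k)" for d e k
    using eb_product[OF hcomp_in _ hcomp_in, of a d b e n] \<open>a \<in> EB\<close> \<open>b \<in> EB\<close>
      hcomp_Vn[OF Y_Vn[OF hcomp_in[of a d] hcomp_in[of b e] refl, of n], of k]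
    by (auto simp: EB_def)
  ultimately show "Y V a n b \<in> EB"
    by (auto simp: EB_def intro!: eb_sum)
qed


lemma wt_mono_abs: "\<bar>x\<bar> \<le> \<bar>m\<bar> \<Longrightarrow> \<bar>y\<bar> \<le> \<bar>n\<bar> \<Longrightarrow> wt x y ^ p \<le> wt m n ^ p"
proof (rule power_mono[OF _ wt_nonneg])
  assume "\<bar>x\<bar> \<le> \<bar>m\<bar>" "\<bar>y\<bar> \<le> \<bar>n\<bar>"
  then show "wt x y \<le> wt m n"
    unfolding wt_def by (intro add_mono order.refl) (simp_all only: of_int_le_iff)
qed

subsection \<open>Energy bounds\<close>

text \<open>This bounds \<open>mode V a m\<close> for inhomogeneous a: each component has its own
  shift d - 1, absorbed by \<open>eb_shiftE\<close>.\<close>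

lemma shifted_sum_bound:
  assumes "finite D" "\<And>d. d \<in> D \<Longrightarrow> eb (g d)"
  shows "\<exists>C p. C \<ge> 0 \<and> (\<forall>m n. \<forall>c\<in>Vn V n.
    vnorm V (\<Sum>d\<in>D. Y V (g d) (m + d - 1) c) \<le> C * wt m n ^ p * vnorm V c)"
  using assms
proof (induction D rule: finite_induct)
  case empty
  then show ?case by (intro exI[of _ 0]) simp
next
  case (insert x D)
  obtain C p where C: "C \<ge> 0" "\<forall>m n. \<forall>c\<in>Vn V n.
    vnorm V (\<Sum>d\<in>D. Y V (g d) (m + d - 1) c) \<le> C * wt m n ^ p * vnorm V c"
    using insert by blast
  have "eb (g x)" using insert.prems by simp
  then obtain B q where B: "B \<ge> 0" "\<And>m n c. c \<in> Vn V n \<Longrightarrow>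
      vnorm V (Y V (g x) (m + (x - 1)) c) \<le> B * wt m n ^ q * vnorm V c"
    using eb_shiftE[of "g x" "x - 1"] by metis
  show ?case
  proof (intro exI conjI allI ballI)
    show "B + C \<ge> 0" using B C by simp
    fix m n c assume c: "c \<in> Vn V n"
    have "vnorm V (\<Sum>d\<in>insert x D. Y V (g d) (m + d - 1) c)
        \<le> vnorm V (Y V (g x) (m + x - 1) c) + vnorm V (\<Sum>d\<in>D. Y V (g d) (m + d - 1) c)"
      unfolding sum.insert[OF insert.hyps] by (rule vnorm_add)
    also have "\<dots> \<le> (B + C) * wt m n ^ (q + p) * vnorm V c"
    proof (rule wt_bound_sum)
      show "vnorm V (Y V (g x) (m + x - 1) c) \<le> B * wt m n ^ q * vnorm V c"
        using B(2)[OF c, of m] by (simp only: add_diff_eq)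
      show "vnorm V (\<Sum>d\<in>D. Y V (g d) (m + d - 1) c) \<le> C * wt m n ^ p * vnorm V c"
        using C(2) c by blast
    qed (use B C in auto)
    finally show "vnorm V (\<Sum>d\<in>insert x D. Y V (g d) (m + d - 1) c)
        \<le> (B + C) * wt m n ^ (q + p) * vnorm V c" .
  qed
qed

lemma hcomp_Vle:
  assumes "b \<in> Vle V n" "k \<notin> {0..n}"
  shows "hcomp V b k = 0"
proof -
  have "Vle V n \<subseteq> {b. hcomp V b k = 0}"
    unfolding Vle_def
  proof (rule vs.span_minimal)
    show "vs.subspace {b. hcomp V b k = 0}"
      unfolding vs.subspace_def by (auto simp: hcomp_add hcomp_sc)
  qed (use assms(2) in \<open>auto simp: hcomp_Vn\<close>)
  then show ?thesis using assms(1) by blast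
qed

text \<open>Components are orthogonal, so the k-th one pairs with b to its own squared norm;
  Cauchy-Schwarz then cancels one factor.\<close>

lemma vnorm_hcomp_le: "vnorm V (hcomp V b k) \<le> vnorm V b"
proof -
  let ?D = "{d. hcomp V b d \<noteq> 0}"
  have "ip V (hcomp V b k) b = ip V (hcomp V b k) (\<Sum>d\<in>?D. hcomp V b d)"
    using sum_hcomp[of b] by (rule arg_cong)
  also have "\<dots> = (\<Sum>d\<in>?D. ip V (hcomp V b k) (hcomp V b d))"
    by (rule ip_sum2)
  also have "\<dots> = (\<Sum>d\<in>?D. if d = k then ip V (hcomp V b k) (hcomp V b k) else 0)"
    by (intro sum.cong refl) (auto intro: orthogonal[OF hcomp_in hcomp_in])
  also have "\<dots> = ip V (hcomp V b k) (hcomp V b k)"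
    using finite_hcomp[of b] by (simp add: sum.delta)
  finally have "complex_of_real ((vnorm V (hcomp V b k))\<^sup>2) = ip V (hcomp V b k) b"
    by (simp only: ip_self)
  then have "(vnorm V (hcomp V b k))\<^sup>2 = cmod (ip V (hcomp V b k) b)"
    by (metis norm_of_real abs_of_nonneg zero_le_power2)
  then have "vnorm V (hcomp V b k) * vnorm V (hcomp V b k) \<le> vnorm V (hcomp V b k) * vnorm V b"
    using cauchy_schwarz[of "hcomp V b k" b] by (simp add: power2_eq_square)
  then show ?thesis
    by (metis mult_le_cancel_left_pos vnorm_nonneg order.not_eq_order_implies_strict)
qed

text \<open>A unit vector of V_(\<le> n) has at most 1 + |n| components, each of norm at most 1. The
  triangle inequality therefore costs one extra power of 1 + |n|.\<close>

lemma EB_energy_bounds: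
  assumes a: "a \<in> EB"
  shows "energy_bounds V a"
proof -
  let ?D = "{d. hcomp V a d \<noteq> 0}"
  obtain C p where C: "C \<ge> 0" "\<And>m n c. c \<in> Vn V n \<Longrightarrow>
    vnorm V (\<Sum>d\<in>?D. Y V (hcomp V a d) (m + d - 1) c) \<le> C * wt m n ^ p * vnorm V c"
    using shifted_sum_bound[OF finite_hcomp, of a "hcomp V a"] a unfolding EB_def by blast
  have bound: "vnorm V (mode V a m b) \<le> C * (1 + real_of_int \<bar>m\<bar>) ^ p * (1 + real_of_int \<bar>n\<bar>) ^ (p + 1)"
    if b: "b \<in> Vle V n" "vnorm V b \<le> 1" for m n b
  proof -
    have "b = (\<Sum>k\<in>{0..n}. hcomp V b k)"
      by (rule sum_hcomp_superset) (simp, use hcomp_Vle[OF b(1)] in blast)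
    then have "mode V a m b = mode V a m (\<Sum>k\<in>{0..n}. hcomp V b k)"
      by (rule arg_cong)
    also have "\<dots> = (\<Sum>k\<in>{0..n}. \<Sum>d\<in>?D. Y V (hcomp V a d) (m + d - 1) (hcomp V b k))"
      unfolding mode_def Y_sum2 by (rule sum.swap)
    finally have "vnorm V (mode V a m b)
        \<le> (\<Sum>k\<in>{0..n}. vnorm V (\<Sum>d\<in>?D. Y V (hcomp V a d) (m + d - 1) (hcomp V b k)))"
      using vnorm_sum by simp
    also have "\<dots> \<le> of_nat (card {0..n}) * (C * wt m n ^ p)"
    proof (rule sum_bounded_above)
      fix k assume k: "k \<in> {0..n}"
      have "vnorm V (\<Sum>d\<in>?D. Y V (hcomp V a d) (m + d - 1) (hcomp V b k))
          \<le> C * wt m k ^ p * vnorm V (hcomp V b k)"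
        by (rule C(2)) simp
      also have "\<dots> \<le> C * wt m n ^ p * 1"
        using k C(1) order.trans[OF vnorm_hcomp_le b(2)]
        by (intro mult_mono mult_left_mono wt_mono_abs) auto
      finally show "vnorm V (\<Sum>d\<in>?D. Y V (hcomp V a d) (m + d - 1) (hcomp V b k)) \<le> C * wt m n ^ p"
        by simp
    qed
    also have "\<dots> \<le> (1 + real_of_int \<bar>n\<bar>) * (C * ((1 + real_of_int \<bar>m\<bar>) * (1 + real_of_int \<bar>n\<bar>)) ^ p)"
    proof (intro mult_mono mult_left_mono power_mono)
      show "wt m n \<le> (1 + real_of_int \<bar>m\<bar>) * (1 + real_of_int \<bar>n\<bar>)"
        unfolding wt_def by (simp add: algebra_simps)
    qed (use C(1) in auto)
    finally show ?thesis
      by (simp add: power_mult_distrib mult_ac)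
  qed
  show ?thesis
    unfolding energy_bounds_def
  proof (intro exI conjI allI)
    show "real (p + 1) \<ge> 0" "C \<ge> 0" "real p \<ge> 0" using C(1) by auto
    fix m n
    show "restr_norm V (mode V a m) n
        \<le> ereal (C * (1 + real_of_int \<bar>m\<bar>) powr real p * (1 + real_of_int \<bar>n\<bar>) powr real (p + 1))"
      unfolding restr_norm_def
    proof (rule SUP_least)
      fix b assume "b \<in> {b. b \<in> Vle V n \<and> vnorm V b \<le> 1}"
      then have "vnorm V (mode V a m b) \<le> C * (1 + real_of_int \<bar>m\<bar>) ^ p * (1 + real_of_int \<bar>n\<bar>) ^ (p + 1)"
        using bound by blast
      also have "\<dots> = C * (1 + real_of_int \<bar>m\<bar>) powr real p * (1 + real_of_int \<bar>n\<bar>) powr real (p + 1)"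
        by (subst (1 2) powr_realpow) auto
      finally show "ereal (vnorm V (mode V a m b))
        \<le> ereal (C * (1 + real_of_int \<bar>m\<bar>) powr real p * (1 + real_of_int \<bar>n\<bar>) powr real (p + 1))"
        by simp
    qed
  qed
qed

text \<open>The criterion applied to all three kinds of generators. The commutator bound controls
  a_m and a_(-m) for m > 0; the zero mode then comes from [L_1, a_(-1)] = d a_0, which is where L_1
  a = 0 and d > 0 enter. As products, a_0 is a_(d-1) and a_(-1) is a_(d-2).\<close>

lemma eb_hermitianI:
  assumes a: "a \<in> Vn V d" "hermitian V a" "Lmode V 1 a = 0" "d > 0" and C: "C \<ge> 0"
    and comm: "\<And>m n c. m > 0 \<Longrightarrow> n \<ge> 0 \<Longrightarrow> c \<in> Vn V n \<Longrightarrow>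
      vnorm V (Y V a (m + d - 1) (Y V a (- m + d - 1) c) - Y V a (- m + d - 1) (Y V a (m + d - 1) c))
        \<le> C * wt m n ^ p * vnorm V c"
  shows "eb a"
proof -
  have pm: "vnorm V (Y V a (m + d - 1) c) \<le> (1 + C) * wt m n ^ (p + 1) * vnorm V c
      \<and> vnorm V (Y V a (- m + d - 1) c) \<le> (1 + C) * wt m n ^ (p + 1) * vnorm V c"
    if m: "m > 0" and n: "n \<ge> 0" and c: "c \<in> Vn V n" for m n c
  proof -
    let ?A = "Y V a (m + d - 1)" and ?B = "Y V a (- m + d - 1)" and ?K = "C * wt m n ^ p"
    have adj: "ip V b (?A c) = ip V (?B b) c" for b c
      using a by (intro adjoint) auto
    have K: "?K \<ge> 0" using C by simp
    \<comment> \<open>Monotonicity of the weight replaces the energy l by n, giving the uniform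
      constant that \<open>lowering_bound\<close> requires.\<close>
    have comm': "vnorm V (?A (?B c) - ?B (?A c)) \<le> ?K * vnorm V c" if "l \<le> n" "c \<in> Vn V l" for l c
    proof (cases "l < 0")
      case True
      then have "c = 0" using that Vn_neg by blast
      then show ?thesis by simp
    next
      case False
      have "vnorm V (?A (?B c) - ?B (?A c)) \<le> C * wt m l ^ p * vnorm V c"
        using comm m that False by simp
      also have "\<dots> \<le> ?K * vnorm V c"
        using that False C by (intro mult_right_mono mult_left_mono wt_mono_abs) auto
      finally show ?thesis .
    qed
    have "(vnorm V (?A c))\<^sup>2 \<le> real_of_int n * ?K * (vnorm V c)\<^sup>2"
      by (rule lowering_bound[OF adj _ m comm' K n order.refl c]) (auto intro: Y_Vn[OF a(1)])
    moreover have "(vnorm V (?B c))\<^sup>2 \<le> (vnorm V (?A c))\<^sup>2 + ?K * (vnorm V c)\<^sup>2"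
      by (rule raising_le_lowering[OF adj comm'[OF order.refl c]])
    moreover have "?K * (vnorm V c)\<^sup>2 \<ge> 0" using C by simp
    ultimately have le: "(vnorm V (?A c))\<^sup>2 \<le> (1 + real_of_int n) * (?K * (vnorm V c)\<^sup>2)"
        "(vnorm V (?B c))\<^sup>2 \<le> (1 + real_of_int n) * (?K * (vnorm V c)\<^sup>2)"
      by (simp_all add: distrib_right mult.assoc)
    have "(1 + real_of_int n) * (?K * (vnorm V c)\<^sup>2) \<le> wt m n * (?K * (vnorm V c)\<^sup>2)"
      using C n by (intro mult_right_mono) (auto simp: wt_def)
    also have "\<dots> = C * wt m n ^ (p + 1) * (vnorm V c)\<^sup>2"
      by (simp add: mult_ac)
    \<comment> \<open>A square root is avoided by enlarging: C \<le> (1 + C)^2, and x \<le> x^2 for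
      x \<ge> 1.\<close>
    also have "\<dots> \<le> (1 + C)\<^sup>2 * (wt m n ^ (p + 1))\<^sup>2 * (vnorm V c)\<^sup>2"
    proof (intro mult_right_mono mult_mono)
      show "C \<le> (1 + C)\<^sup>2" using C by (simp add: power2_eq_square algebra_simps)
      show "wt m n ^ (p + 1) \<le> (wt m n ^ (p + 1))\<^sup>2"
        using one_le_power[OF wt_ge_1, of m n "p + 1"] self_le_power[of "wt m n ^ (p + 1)" 2] by simp
    qed auto
    also have "\<dots> = ((1 + C) * wt m n ^ (p + 1) * vnorm V c)\<^sup>2"
      by (simp only: power_mult_distrib)
    finally have *: "(1 + real_of_int n) * (?K * (vnorm V c)\<^sup>2) \<le> ((1 + C) * wt m n ^ (p + 1) * vnorm V c)\<^sup>2" .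
    show ?thesis
      using C by (intro conjI power2_le_imp_le[OF order.trans[OF le(1) *]] power2_le_imp_le[OF order.trans[OF le(2) *]]) auto
  qed
  have neg: "Y V a k c = 0" if "c \<in> Vn V n" "n < 0" for k n c
    using Vn_neg[OF that] by simp
  have zero: "vnorm V (Y V a (d - 1) c) \<le> 4 * (1 + C) * 3 ^ (p + 1) * wt 0 n ^ (p + 2) * vnorm V c"
    if n: "n \<ge> 0" and c: "c \<in> Vn V n" for n c
  proof -
    let ?X = "(1 + C) * (3 * wt 0 n) ^ (p + 1)"
    have X: "?X \<ge> 0" using C by simp
    \<comment> \<open>The mode a_(-1) acts below at energies n and n - 1; up to energy n + 1,
      \<open>wt 1 k\<close> is at most 3 + n, hence at most \<open>3 * wt 0 n\<close>.\<close>
    have w: "(1 + C) * wt 1 k ^ (p + 1) \<le> ?X" if "k \<le> n + 1" "k \<ge> 0" for k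
      using that C by (intro mult_left_mono power_mono) (auto simp: wt_def)
    \<comment> \<open>In \<open>L1_comm\<close> with q = d - 2 the coefficient is -(2 + q) + 2 d =
      d.\<close>
    have "Lmode V 1 (Y V a (d - 2) c) - Y V a (d - 2) (Lmode V 1 c)
        = sc V (of_int d) (Y V a (d - 1) c)"
      using L1_comm[of a "d - 2" c] a(1,3) by (simp add: Vn_def Y_sc1 flip: vs.scale_left_diff_distrib)
    then have "real_of_int d * vnorm V (Y V a (d - 1) c)
        = vnorm V (Lmode V 1 (Y V a (d - 2) c) - Y V a (d - 2) (Lmode V 1 c))"
      using a(4) by (simp add: vnorm_sc)
    also have "\<dots> \<le> vnorm V (Lmode V 1 (Y V a (d - 2) c)) + vnorm V (Y V a (d - 2) (Lmode V 1 c))"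
      by (rule vnorm_diff)
    also have "vnorm V (Lmode V 1 (Y V a (d - 2) c)) \<le> 2 * real_of_int (n + 1) * (?X * vnorm V c)"
    proof -
      have "Y V a (d - 2) c \<in> Vn V (n + 1)" by (rule Y_Vn[OF a(1) c]) simp
      then have "vnorm V (Lmode V 1 (Y V a (d - 2) c)) \<le> 2 * real_of_int (n + 1) * vnorm V (Y V a (d - 2) c)"
        by (rule L1_bound(1)) (use n in simp)
      also have "vnorm V (Y V a (d - 2) c) \<le> (1 + C) * wt 1 n ^ (p + 1) * vnorm V c"
        using pm[of 1 n c] n c by simp
      also have "\<dots> \<le> ?X * vnorm V c"
        using n by (intro mult_right_mono w) auto
      finally show ?thesis using n by (simp add: mult_left_mono)
    qed
    also have "vnorm V (Y V a (d - 2) (Lmode V 1 c)) \<le> ?X * (2 * real_of_int (n + 1) * vnorm V c)"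
    proof (cases "n = 0")
      case True
      have "Lmode V 1 c = 0"
        using Vn_neg[OF L_Vn[OF c refl], of 1] True by simp
      then show ?thesis using X n by simp
    next
      case False
      have "Lmode V 1 c \<in> Vn V (n - 1)" by (rule L_Vn[OF c refl])
      then have "vnorm V (Y V a (d - 2) (Lmode V 1 c)) \<le> (1 + C) * wt 1 (n - 1) ^ (p + 1) * vnorm V (Lmode V 1 c)"
        using pm[of 1 "n - 1"] n False by simp
      also have "\<dots> \<le> ?X * (2 * real_of_int n * vnorm V c)"
        using n False X L1_bound(1)[OF c n] by (intro mult_mono w) auto
      also have "\<dots> \<le> ?X * (2 * real_of_int (n + 1) * vnorm V c)"
        using X by (intro mult_left_mono mult_right_mono) auto
      finally show ?thesis .
    qed
    finally have "real_of_int d * vnorm V (Y V a (d - 1) c)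
        \<le> 2 * real_of_int (n + 1) * (?X * vnorm V c) + ?X * (2 * real_of_int (n + 1) * vnorm V c)"
      by simp
    also have "\<dots> = 4 * ?X * wt 0 n * vnorm V c"
      using n by (simp add: wt_def algebra_simps)
    also have "\<dots> = 4 * (1 + C) * 3 ^ (p + 1) * wt 0 n ^ (p + 2) * vnorm V c"
      by (simp add: power_mult_distrib mult_ac power_add power2_eq_square)
    finally have "real_of_int d * vnorm V (Y V a (d - 1) c)
        \<le> 4 * (1 + C) * 3 ^ (p + 1) * wt 0 n ^ (p + 2) * vnorm V c" .
    moreover have "1 * vnorm V (Y V a (d - 1) c) \<le> real_of_int d * vnorm V (Y V a (d - 1) c)"
      using a(4) by (intro mult_right_mono) auto
    ultimately show ?thesis by simp
  qed
  show ?thesis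
  proof (rule eb_shiftI)
    show "4 * (1 + C) * 3 ^ (p + 1) \<ge> 0" using C by simp
    fix m n c assume c: "c \<in> Vn V n"
    have up: "x \<le> 4 * (1 + C) * 3 ^ (p + 1) * wt m n ^ (p + 2) * vnorm V c"
      if "x \<le> (1 + C) * wt k n ^ (p + 1) * vnorm V c" "\<bar>k\<bar> = \<bar>m\<bar>" for x k
    proof (rule order.trans[OF that(1)], intro mult_right_mono mult_mono)
      have "(1 + C) * 1 \<le> (1 + C) * (4 * 3 ^ (p + 1))"
        using C one_le_power[of "3 :: real" "p + 1"] by (intro mult_left_mono) auto
      then show "1 + C \<le> 4 * (1 + C) * 3 ^ (p + 1)"
        by (simp only: mult_ac mult_1_right mult_1_left)
      show "wt k n ^ (p + 1) \<le> wt m n ^ (p + 2)"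
        using wt_power_mono[of "p + 1" "p + 2" m n] that(2) by (simp add: wt_def)
    qed (use C in auto)
    consider "n < 0" | "n \<ge> 0" "m = 0" | "n \<ge> 0" "m > 0" | "n \<ge> 0" "m < 0" by linarith
    then have "vnorm V (Y V a (m + d - 1) c) \<le> 4 * (1 + C) * 3 ^ (p + 1) * wt m n ^ (p + 2) * vnorm V c"
    proof cases
      case 1
      then show ?thesis using C neg[OF c] by simp
    next
      case 2
      then show ?thesis using zero[OF _ c] by simp
    next
      case 3
      then show ?thesis by (intro up[OF conjunct1[OF pm[OF _ _ c]]]) auto
    next
      case 4
      then show ?thesis by (intro up[OF conjunct2[OF pm[of "- m" n c, unfolded minus_minus]]]) (use c in auto)
    qed
    then show "vnorm V (Y V a (m + (d - 1)) c) \<le> 4 * (1 + C) * 3 ^ (p + 1) * wt m n ^ (p + 2) * vnorm V c"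
      by (simp only: add_diff_eq)
  qed
qed


subsection \<open>Virasoro vectors\<close>

text \<open>The relation [L~_0, L~_(-2)] = 2 L~_(-2) on the vacuum reads a_(1) a = 2 a. For a of
  degree d the left side has degree 2 d - 2, so d = 2 unless a = 0, and 0 lies in every
  degree.\<close>

lemma virasoro_V2:
  assumes "virasoro_vector V a z"
  shows "a \<in> Vn V 2"
proof -
  obtain d where d: "a \<in> Vn V d" using assms unfolding virasoro_vector_def homogeneous_def by blast
  have "Y V a (0+1) (Y V a (-2+1) (vac V)) - Y V a (-2+1) (Y V a (0+1) (vac V)) =
        sc V (of_int (0 - (-2))) (Y V a (0+(-2)+1) (vac V)) +
        sc V (z / 12 * of_int (0^3 - 0) * (if (0::int) = -(-2) then 1 else 0)) (vac V)"
    using assms unfolding virasoro_vector_def by blast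
  then have eq: "Y V a 1 a = sc V 2 a" by (simp add: Y_creation)
  have "Y V a 1 a \<in> Vn V (2 * d - 2)" by (rule Y_Vn[OF d d]) simp
  then have "sc V (1/2) (Y V a 1 a) \<in> Vn V (2 * d - 2)" by (rule Vn_sc)
  then have "a \<in> Vn V (2 * d - 2)" by (simp add: eq)
  then have "d = 2 \<or> a = 0" using Vn_inter[OF d, of "2 * d - 2"] by force
  then show ?thesis using d by auto
qed

text \<open>[a_m, a_(-m)] contains 2 m a_0, so \<open>eb_hermitianI\<close> asks for a bound on the
  zero mode beforehand. The modes a_1 and a_(-1) are therefore treated first, then a_0, and the
  criterion is applied last.\<close>

lemma eb_virasoro:
  assumes a: "hermitian V a" "quasi_primary V a" "virasoro_vector V a z"
  shows "eb a"
proof -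
  have a2: "a \<in> Vn V 2" using virasoro_V2[OF a(3)] .
  have L1: "Lmode V 1 a = 0" using a(2) by (simp add: quasi_primary_def)
  have vir: "Y V a (m+1) (Y V a (n+1) v) - Y V a (n+1) (Y V a (m+1) v) =
        sc V (of_int (m - n)) (Y V a (m+n+1) v) +
        sc V (z / 12 * of_int (m^3 - m) * (if m = -n then 1 else 0)) v" for m n v
    using a(3) unfolding virasoro_vector_def by blast
  let ?A = "Y V a 2" and ?B = "Y V a 0"
  have adj: "ip V b (?A c) = ip V (?B b) c" and adj': "ip V b (?B c) = ip V (?A b) c" for b c
    using a2 a(1) by (auto intro: adjoint)
  have comm1: "?A (?B c) - ?B (?A c) = sc V 2 (Y V a 1 c)" for c
    using vir[of 1 "-1" c] by simp
  have comm2: "Lmode V 1 (?B c) - ?B (Lmode V 1 c) = sc V 2 (Y V a 1 c)" for c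
    using L1_comm[of a 0 c] a2 L1 by (simp add: Vn_def Y_sc1 flip: vs.scale_left_diff_distrib)
  have raise: "vnorm V (?B c) \<le> vnorm V (?A c) + 2 * (real_of_int n + 1) * vnorm V c"
    if n: "n \<ge> 0" and c: "c \<in> Vn V n" for n c
  proof -
    let ?x = "vnorm V (?A c)" and ?y = "vnorm V (?B c)" and ?l = "2 * (real_of_int n + 1) * vnorm V c"
    \<comment> \<open>Replacing [A, B] by [L_1, B] and moving operators to the other side leaves A
      and B to first order only, paired with L_1 c and L_(-1) c, whose norms are known.\<close>
    have "complex_of_real (?y\<^sup>2) = of_real (?x\<^sup>2) + ip V c (Lmode V 1 (?B c) - ?B (Lmode V 1 c))"
      using norm_adjoint_commutator[of ?A ?B c, OF adj] unfolding comm1 comm2 .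
    also have "ip V c (Lmode V 1 (?B c) - ?B (Lmode V 1 c))
        = ip V (Lmode V (-1) c) (?B c) - ip V (?A c) (Lmode V 1 c)"
      unfolding ip_diff2 adj' adjoint_L ..
    finally have "?y\<^sup>2 = ?x\<^sup>2 + Re (ip V (Lmode V (-1) c) (?B c)) - Re (ip V (?A c) (Lmode V 1 c))"
      by (metis Re_complex_of_real add_diff_eq minus_complex.sel(1) plus_complex.sel(1))
    moreover have "Re (ip V (Lmode V (-1) c) (?B c)) \<le> ?l * ?y"
      using complex_Re_le_cmod order.trans[OF cauchy_schwarz mult_right_mono[OF L1_bound(2)[OF c n] vnorm_nonneg]]
        order.trans by blast
    moreover have "- Re (ip V (?A c) (Lmode V 1 c)) \<le> ?x * ?l"
    proof -
      have "- Re (ip V (?A c) (Lmode V 1 c)) \<le> ?x * vnorm V (Lmode V 1 c)"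
        using abs_Re_le_cmod[of "ip V (?A c) (Lmode V 1 c)"] cauchy_schwarz[of "?A c" "Lmode V 1 c"] by linarith
      also have "\<dots> \<le> ?x * ?l"
        by (intro mult_left_mono order.trans[OF L1_bound(1)[OF c n]] mult_right_mono) auto
      finally show ?thesis .
    qed
    ultimately have "?y\<^sup>2 \<le> ?x\<^sup>2 + ?l * ?y + ?x * ?l"
      by linarith
    \<comment> \<open>This is y^2 - x^2 \<le> l (x + y) rearranged. Dividing by x + y gives the
      claim, which is trivial when x + y = 0.\<close>
    then have "(?y + ?x) * ?y \<le> (?y + ?x) * (?x + ?l)"
      by (simp add: power2_eq_square algebra_simps)
    then have "?y \<le> ?x + ?l" if "?y + ?x > 0"
      using that by (simp only: mult_le_cancel_left_pos)
    moreover have "0 \<le> ?l" using n by simp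
    ultimately show ?thesis
      using vnorm_nonneg[of "?A c"] vnorm_nonneg[of "?B c"] by linarith
  qed
  \<comment> \<open>The factor n (n + 1) solves the recursion: (n - 1) n from the induction
    hypothesis plus 2 n from \<open>raise\<close> at energy n - 1.\<close>
  have lower: "vnorm V (?A c) \<le> real_of_int n * (real_of_int n + 1) * vnorm V c"
    if "n \<ge> 0" "c \<in> Vn V n" for n c
    using that
  proof (induction "nat n" arbitrary: n c rule: less_induct)
    case less
    let ?e = "?A c"
    have e: "?e \<in> Vn V (n - 1)" by (rule Y_Vn[OF a2 less.prems(2)]) simp
    show ?case
    proof (cases "n = 0")
      case True
      then show ?thesis using Vn_neg[OF e] by simp
    next
      case False
      have "vnorm V (?A ?e) \<le> real_of_int (n - 1) * (real_of_int (n - 1) + 1) * vnorm V ?e"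
        using less.hyps[of "n - 1" ?e] less.prems e False by simp
      moreover have "vnorm V (?B ?e) \<le> vnorm V (?A ?e) + 2 * (real_of_int (n - 1) + 1) * vnorm V ?e"
        using raise[of "n - 1" ?e] less.prems e False by simp
      ultimately have "vnorm V (?B ?e) \<le> real_of_int n * (real_of_int n + 1) * vnorm V ?e"
        by (simp add: algebra_simps)
      then have "vnorm V (?B ?e) * vnorm V c \<le> real_of_int n * (real_of_int n + 1) * vnorm V ?e * vnorm V c"
        by (rule mult_right_mono) simp
      then have "vnorm V ?e * vnorm V ?e \<le> vnorm V ?e * (real_of_int n * (real_of_int n + 1) * vnorm V c)"
        using norm_le_adjoint[of ?A ?B c, OF adj] by (simp add: power2_eq_square mult_ac)
      moreover have "0 \<le> real_of_int n * (real_of_int n + 1) * vnorm V c" using less.prems by simp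
      ultimately show ?thesis
        by (cases "vnorm V ?e = 0") (simp, metis mult_le_cancel_left_pos vnorm_nonneg order.not_eq_order_implies_strict)
    qed
  qed
  \<comment> \<open>With N = n + 1, the two terms of 2 a_0 = [L_1, a_(-1)] contribute 4 N^3 and 2
    N^3. The weight may carry any m, since it is always at least N.\<close>
  have zero: "vnorm V (Y V a 1 c) \<le> 3 * wt m n ^ 3 * vnorm V c" if n: "n \<ge> 0" and c: "c \<in> Vn V n" for m n c
  proof -
    let ?N = "1 + real_of_int n"
    have N: "?N \<ge> 0" using n by simp
    have Bc: "vnorm V (?B c') \<le> (real_of_int k + 1) * (real_of_int k + 2) * vnorm V c'"
      if "k \<ge> 0" "c' \<in> Vn V k" for k c'
      using raise[OF that] lower[OF that] by (simp add: algebra_simps)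
    have "2 * vnorm V (Y V a 1 c) = vnorm V (Lmode V 1 (?B c) - ?B (Lmode V 1 c))"
      unfolding comm2 vnorm_sc by simp
    also have "\<dots> \<le> vnorm V (Lmode V 1 (?B c)) + vnorm V (?B (Lmode V 1 c))"
      by (rule vnorm_diff)
    also have "vnorm V (Lmode V 1 (?B c)) \<le> 4 * ?N ^ 3 * vnorm V c"
    proof -
      have "?B c \<in> Vn V (n + 1)" by (rule Y_Vn[OF a2 c]) simp
      then have "vnorm V (Lmode V 1 (?B c)) \<le> 2 * real_of_int (n + 1) * vnorm V (?B c)"
        by (rule L1_bound(1)) (use n in simp)
      also have "\<dots> \<le> 2 * real_of_int (n + 1) * (?N * (2 * ?N) * vnorm V c)"
        using n by (intro mult_left_mono order.trans[OF Bc[OF n c]] mult_right_mono mult_mono) auto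
      finally show ?thesis by (simp add: power3_eq_cube algebra_simps)
    qed
    also have "vnorm V (?B (Lmode V 1 c)) \<le> 2 * ?N ^ 3 * vnorm V c"
    proof (cases "n = 0")
      case True
      have "Lmode V 1 c = 0"
        using Vn_neg[OF L_Vn[OF c refl], of 1] True by simp
      then show ?thesis using n by simp
    next
      case False
      have "Lmode V 1 c \<in> Vn V (n - 1)" by (rule L_Vn[OF c refl])
      then have "vnorm V (?B (Lmode V 1 c)) \<le> real_of_int n * (real_of_int n + 1) * vnorm V (Lmode V 1 c)"
        using Bc[of "n - 1" "Lmode V 1 c"] n False by (simp add: add.commute)
      also have "\<dots> \<le> ?N * ?N * (2 * ?N * vnorm V c)"
        using n by (intro mult_mono order.trans[OF L1_bound(1)[OF c n]]) auto
      finally show ?thesis by (simp add: power3_eq_cube algebra_simps)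
    qed
    finally have "vnorm V (Y V a 1 c) \<le> 3 * ?N ^ 3 * vnorm V c"
      by (simp add: mult_ac)
    also have "\<dots> \<le> 3 * wt m n ^ 3 * vnorm V c"
      using n by (intro mult_right_mono mult_left_mono power_mono) (auto simp: wt_def)
    finally show ?thesis .
  qed
  show ?thesis
  proof (rule eb_hermitianI[OF a2 a(1) L1])
    \<comment> \<open>The 6 is 2 m times the zero-mode constant 3, and |z| covers the central term;
      both are measured against the fourth power of the weight.\<close>
    show "6 + cmod z \<ge> 0" by simp
    fix m n :: int and c assume m: "m > 0" and n: "n \<ge> 0" and c: "c \<in> Vn V n"
    have mw: "real_of_int m \<le> wt m n" using m by (simp add: wt_def)
    have "Y V a (m + 1) (Y V a (- m + 1) c) - Y V a (- m + 1) (Y V a (m + 1) c)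
        = sc V (of_int (2 * m)) (Y V a 1 c) + sc V (z / 12 * of_int (m^3 - m)) c"
      using vir[of m "-m" c] by simp
    also have "vnorm V \<dots> \<le> 2 * real_of_int m * vnorm V (Y V a 1 c) + cmod (z / 12 * of_int (m^3 - m)) * vnorm V c"
      using m by (intro order.trans[OF vnorm_add]) (simp add: vnorm_sc)
    also have "\<dots> \<le> 2 * wt m n * (3 * wt m n ^ 3 * vnorm V c) + cmod z * wt m n ^ 4 * vnorm V c"
    proof (intro add_mono mult_mono mult_right_mono mult_left_mono zero n c mw)
      have "m * 1 \<le> m * m\<^sup>2" using m by (intro mult_left_mono) (auto simp: int_one_le_iff_zero_less)
      then have "\<bar>m^3 - m\<bar> \<le> m ^ 3" using m by (simp add: power2_eq_square power3_eq_cube)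
      then have "real_of_int \<bar>m^3 - m\<bar> \<le> real_of_int m ^ 3"
        by (metis of_int_le_iff of_int_power)
      also have "\<dots> \<le> wt m n ^ 3" using m mw by (intro power_mono) auto
      also have "\<dots> \<le> wt m n ^ 4" by (rule wt_power_mono) simp
      finally have w: "real_of_int \<bar>m^3 - m\<bar> \<le> wt m n ^ 4" .
      have "cmod (z / 12 * of_int (m^3 - m)) = cmod z / 12 * real_of_int \<bar>m^3 - m\<bar>"
        unfolding norm_mult norm_of_int norm_divide by simp
      also have "\<dots> \<le> cmod z * wt m n ^ 4"
        using w by (intro mult_mono) auto
      finally show "cmod (z / 12 * of_int (m^3 - m)) \<le> cmod z * wt m n ^ 4" .
    qed (use m in auto)
    also have "\<dots> = (6 + cmod z) * wt m n ^ 4 * vnorm V c"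
      by (simp add: algebra_simps eval_nat_numeral)
    finally show "vnorm V (Y V a (m + 2 - 1) (Y V a (- m + 2 - 1) c) - Y V a (- m + 2 - 1) (Y V a (m + 2 - 1) c))
        \<le> (6 + cmod z) * wt m n ^ 4 * vnorm V c"
      by (simp add: add.commute)
  qed simp
qed

subsection \<open>Currents\<close>

text \<open>L_1 J is a multiple of the vacuum because V_0 is one-dimensional, and (\<Omega> | L_1 J)
  = (L_(-1) \<Omega> | J) = 0. Thus every current is quasi-primary.\<close>

lemma L1_V1:
  assumes J: "J \<in> Vn V 1"
  shows "Lmode V 1 J = 0"
proof -
  have "Lmode V 1 J \<in> Vn V 0" by (rule L_Vn[OF J]) simp
  then obtain z where z: "Lmode V 1 J = sc V z (vac V)" unfolding V0 by blast
  have "Lmode V (-1) (vac V) = 0" by (simp add: Lmode_def Y_creation)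
  then have "ip V (vac V) (Lmode V 1 J) = 0" unfolding adjoint_L[of _ 1] by simp
  then have "z = 0" by (simp add: z ip_sc2 ip_vac)
  then show ?thesis by (simp add: z)
qed

text \<open>The commutator formula stops at i = 1, where J_(1) J is a multiple of the vacuum. The
  remaining term is a mode of J_(0) J.\<close>

lemma eb_hermitian_current:
  assumes J: "J \<in> Vn V 1" "hermitian V J"
  shows "eb J"
proof -
  have "Y V J 1 J \<in> Vn V 0" by (rule Y_Vn[OF J(1) J(1)]) simp
  then obtain z where z: "Y V J 1 J = sc V z (vac V)" unfolding V0 by blast
  have comm: "Y V J p (Y V J q c) - Y V J q (Y V J p c)
      = Y V (Y V J 0 J) (p + q) c + sc V (of_int p * z) (Y V (vac V) (p + q - 1) c)" for p q c
  proof -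
    have "of_int p gchoose i = (0::complex) \<or> Y V J (int i) J = 0" if "1 < i" for i
      using Y_vanish[OF J(1) J(1), of "int i"] that by simp
    from commutator[of 1 p J J q c, OF this] show ?thesis
      by (simp add: z Y_sc1)
  qed
  \<comment> \<open>Taking p = q = 0 makes the commutator and the scalar term vanish. For p = m, q =
    -m the mode of J_(0) J that occurs is this same one.\<close>
  have zero: "Y V (Y V J 0 J) 0 c = 0" for c
    using comm[of 0 0 c] by simp
  show ?thesis
  proof (rule eb_hermitianI[OF J L1_V1[OF J(1)]])
    show "cmod z \<ge> 0" by simp
    fix m n :: int and c assume m: "m > 0" and n: "n \<ge> 0" and c: "c \<in> Vn V n"
    have "Y V J m (Y V J (- m) c) - Y V J (- m) (Y V J m c) = sc V (of_int m * z) c"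
      using comm[of m "- m" c] by (simp add: zero Y_vac)
    then have "vnorm V (Y V J m (Y V J (- m) c) - Y V J (- m) (Y V J m c)) = cmod z * real_of_int m * vnorm V c"
      using m by (simp add: vnorm_sc norm_mult mult_ac)
    also have "\<dots> \<le> cmod z * wt m n ^ 1 * vnorm V c"
      using m by (intro mult_right_mono mult_left_mono) (auto simp: wt_def)
    finally show "vnorm V (Y V J (m + 1 - 1) (Y V J (- m + 1 - 1) c) - Y V J (- m + 1 - 1) (Y V J (m + 1 - 1) c))
        \<le> cmod z * wt m n ^ 1 * vnorm V c" by simp
  qed simp
qed

text \<open>The involution need not preserve the grading in general. For a current \<open>J\<close>, taking adjoints in
  \<open>[L\<^sub>1, J\<^sub>n] = -n J\<^sub>n\<^sub>+\<^sub>1\<close> and comparing with the translation covariance of \<open>J*\<close> forces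
  \<open>L\<^sub>0 J* = J*\<close>.\<close>

lemma star_V1:
  assumes J: "J \<in> Vn V 1"
  shows "star V J \<in> Vn V 1"
proof -
  define S where "S = star V J"
  let ?E = "{d. hcomp V S d \<noteq> 0}"
  have adj: "ip V b (Y V J n c) = ip V (mode V S (- n) b) c" for b c n
    using invariance[of b J n c] by (simp add: mode_Vn[OF J] S_def)
  have L1: "Lmode V 1 (Y V J n c) - Y V J n (Lmode V 1 c) = sc V (- of_int n) (Y V J (n + 1) c)" for n c
    using L1_comm[of J n c] J L1_V1[OF J]
    by (simp add: Vn_def Y_sc1 vs.scale_left_diff_distrib)
  have op: "Lmode V (-1) (mode V S k b) - mode V S k (Lmode V (-1) b) = sc V (- of_int k) (mode V S (k - 1) b)"
    (is "?l = ?r") for k b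
  proof -
    have eq: "ip V ?l c = ip V ?r c" for c
    proof -
      have "ip V ?l c = ip V b (Y V J (- k) (Lmode V 1 c)) - ip V b (Lmode V 1 (Y V J (- k) c))"
        unfolding ip_diff1 adj adjoint_L[of _ 1] by simp
      also have "\<dots> = - ip V b (Lmode V 1 (Y V J (- k) c) - Y V J (- k) (Lmode V 1 c))"
        by (simp add: ip_diff2)
      also have "\<dots> = - ip V b (sc V (of_int k) (Y V J (- k + 1) c))"
        unfolding L1 by simp
      also have "\<dots> = ip V ?r c"
        unfolding ip_sc2 ip_sc1 adj by simp
      finally show ?thesis .
    qed
    \<comment> \<open>The identity holds in pairing with every vector; positivity of the scalar
      product upgrades it to an equality of vectors.\<close>
    have "ip V (?l - ?r) (?l - ?r) = 0"
      unfolding ip_diff1[of ?l ?r] eq by simp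
    then have "?l - ?r = 0" by (rule ip_self_eq_0)
    then show ?thesis by (simp only: right_minus_eq)
  qed
  \<comment> \<open>On the vacuum, \<open>op\<close> gives every component S_d the factor -k,
    whereas \<open>Lm1_comm\<close> gives it -(k + d - 1). The difference is d - 1.\<close>
  have sum0: "(\<Sum>d\<in>?E. sc V (of_int (d - 1)) (Y V (hcomp V S d) (k + d - 2) (vac V))) = 0" for k
  proof -
    have "Lmode V (-1) (mode V S k (vac V)) - mode V S k (Lmode V (-1) (vac V))
        = (\<Sum>d\<in>?E. Lmode V (-1) (Y V (hcomp V S d) (k + d - 1) (vac V)) - Y V (hcomp V S d) (k + d - 1) (Lmode V (-1) (vac V)))"
      unfolding mode_def Lmode_def Y_sum2 sum_subtractf ..
    also have "\<dots> = (\<Sum>d\<in>?E. sc V (- of_int (k + d - 1)) (Y V (hcomp V S d) (k + d - 2) (vac V)))"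
      unfolding Lm1_comm by simp
    finally have lhs: "Lmode V (-1) (mode V S k (vac V)) - mode V S k (Lmode V (-1) (vac V)) = \<dots>" .
    have rhs: "mode V S (k - 1) (vac V) = (\<Sum>d\<in>?E. Y V (hcomp V S d) (k + d - 2) (vac V))"
      unfolding mode_def by (simp add: algebra_simps)
    note trans[OF lhs[symmetric] op[of k "vac V", unfolded rhs]]
    then have "(\<Sum>d\<in>?E. sc V (- of_int k) (Y V (hcomp V S d) (k + d - 2) (vac V))
        - sc V (- of_int (k + d - 1)) (Y V (hcomp V S d) (k + d - 2) (vac V))) = 0"
      by (simp only: vs.scale_sum_right sum_subtractf) simp
    moreover have "sc V (of_int (d - 1)) x = sc V (- of_int k) x - sc V (- of_int (k + d - 1)) x" for d x
      unfolding vs.scale_left_diff_distrib[symmetric] by simp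
    ultimately show ?thesis by (simp only:)
  qed
  have "hcomp V S d = 0" if "d \<noteq> 1" for d
  proof (rule ccontr)
    assume "hcomp V S d \<noteq> 0"
    with that have ne: "{d. hcomp V S d \<noteq> 0 \<and> d \<noteq> 1} \<noteq> {}" by blast
    have fin: "finite {d. hcomp V S d \<noteq> 0 \<and> d \<noteq> 1}"
      by (rule finite_subset[OF _ finite_hcomp[of S]]) blast
    \<comment> \<open>The least degree other than 1 in which S has a component. For k = 1 - d0 the
      product index in \<open>sum0\<close> is d - d0 - 1: it is -1 for d = d0, where creation
      returns the component, and non-negative for d > d0, where creation gives 0. The term d = 1 has
      coefficient 0.\<close>
    define d0 where "d0 = Min {d. hcomp V S d \<noteq> 0 \<and> d \<noteq> 1}"
    have d0: "hcomp V S d0 \<noteq> 0" "d0 \<noteq> 1" using Min_in[OF fin ne] by (auto simp: d0_def)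
    have min: "d0 \<le> d" if "hcomp V S d \<noteq> 0" "d \<noteq> 1" for d
      unfolding d0_def using fin that by (intro Min_le) auto
    have "(\<Sum>d\<in>?E. sc V (of_int (d - 1)) (Y V (hcomp V S d) (1 - d0 + d - 2) (vac V)))
        = (\<Sum>d\<in>?E. if d = d0 then sc V (of_int (d0 - 1)) (hcomp V S d0) else 0)"
    proof (intro sum.cong refl)
      fix d assume d: "d \<in> ?E"
      consider "d = d0" | "d = 1" "d \<noteq> d0" | "d > d0" using min[of d] d by force
      then show "sc V (of_int (d - 1)) (Y V (hcomp V S d) (1 - d0 + d - 2) (vac V))
          = (if d = d0 then sc V (of_int (d0 - 1)) (hcomp V S d0) else 0)"
        by cases (simp_all add: Y_creation)
    qed
    also have "\<dots> = sc V (of_int (d0 - 1)) (hcomp V S d0)"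
      using d0 finite_hcomp[of S] by (simp add: sum.delta)
    finally show False
      using sum0[of "1 - d0"] d0 by simp
  qed
  then have "S = sum (hcomp V S) {1}"
    by (intro sum_hcomp_superset) auto
  then have "S = hcomp V S 1" by simp
  then show ?thesis unfolding S_def[symmetric] by (metis hcomp_in)
qed

text \<open>J is a complex combination of the Hermitian vectors J + star J and i (J - star J). These
  lie in V_1 by \<open>star_V1\<close>, so the Hermitian case applies.\<close>

lemma eb_current:
  assumes J: "J \<in> Vn V 1"
  shows "eb J"
proof -
  let ?H1 = "J + star V J" and ?H2 = "sc V \<i> (J - star V J)"
  have "star V (J - star V J) = star V J - J"
    using star_add[of "J - star V J" "star V J"] by (simp add: star_star algebra_simps)
  then have "star V ?H2 = sc V (- \<i>) (star V J - J)"
    by (simp only: star_sc complex_cnj_i)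
  then have "hermitian V ?H2"
    by (simp add: hermitian_def vs.scale_right_diff_distrib)
  moreover have "hermitian V ?H1"
    by (simp add: hermitian_def star_add star_star add.commute)
  moreover have "?H1 \<in> Vn V 1" "?H2 \<in> Vn V 1"
    using J star_V1[OF J] by (auto intro: Vn_add Vn_diff Vn_sc)
  ultimately have "eb ?H1" "eb ?H2" by (simp_all only: eb_hermitian_current)
  then have "eb (sc V (1/2) ?H1 + sc V (- \<i> / 2) ?H2)" by (intro eb_add[OF eb_sc eb_sc])
  moreover have "sc V (1/2) ?H1 + sc V (- \<i> / 2) ?H2 = sc V (1/2 + 1/2) J"
    unfolding vs.scale_left_distrib vs.scale_right_distrib vs.scale_right_diff_distrib by simp
  ultimately show ?thesis by simp
qed

subsection \<open>W3 vectors\<close>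

text \<open>In [W_m, W_(-m)] there is a scalar and the zero modes of \<Lambda> and \<nu>, but no
  mode of \<mu>. The Virasoro vector \<nu> is bounded already, and \<Lambda> is built from it by
  products, so \<open>eb_product\<close> bounds it.\<close>

lemma eb_W3:
  assumes W: "W3_vector V \<mu> c"
  shows "eb \<mu>" "\<mu> \<in> Vn V 3"
proof -
  have mu: "hermitian V \<mu>" "\<mu> \<in> Vn V 3" "Lmode V 1 \<mu> = 0"
    using W by (auto simp: W3_vector_def primary_def)
  show "\<mu> \<in> Vn V 3" by fact
  obtain \<nu> where nu: "hermitian V \<nu>" "quasi_primary V \<nu>" "virasoro_vector V \<nu> (complex_of_real c)"
    and rel: "\<And>m n v. Y V \<mu> (m + 2) (Y V \<mu> (n + 2) v) - Y V \<mu> (n + 2) (Y V \<mu> (m + 2) v) =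
             sc V (complex_of_real (c / (3 * 120) * real_of_int ((m^2 - 4) * (m^2 - 1) * m))
                     * (if m + n = 0 then 1 else 0)) v
           + sc V (complex_of_real (16 / (22 + 5 * c) * real_of_int (m - n)))
              (mode V (mode V \<nu> (-2) \<nu> - sc V (3/10) (mode V \<nu> (-1) (mode V \<nu> (-1) \<nu>))) (m + n) v)
           + sc V (complex_of_real (1/20 * real_of_int ((m - n) * (2*m^2 - m*n + 2*n^2 - 8))))
                 (Y V \<nu> (m + n + 1) v)"
    using W unfolding W3_vector_def Let_def by blast
  have nu2: "\<nu> \<in> Vn V 2" using virasoro_V2[OF nu(3)] .
  have ebnu: "eb \<nu>" using eb_virasoro[OF nu] .
  define \<Lambda> where "\<Lambda> = mode V \<nu> (-2) \<nu> - sc V (3/10) (mode V \<nu> (-1) (mode V \<nu> (-1) \<nu>))"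
  have \<Lambda>: "\<Lambda> = Y V \<nu> (-1) \<nu> - sc V (3/10) (Y V \<nu> 0 (Y V \<nu> 0 \<nu>))"
    by (simp add: \<Lambda>_def mode_Vn[OF nu2])
  have V3: "Y V \<nu> 0 \<nu> \<in> Vn V 3" by (rule Y_Vn[OF nu2 nu2]) simp
  have V4: "Y V \<nu> (-1) \<nu> \<in> Vn V 4" by (rule Y_Vn[OF nu2 nu2]) simp
  have V4': "Y V \<nu> 0 (Y V \<nu> 0 \<nu>) \<in> Vn V 4" by (rule Y_Vn[OF nu2 V3]) simp
  have \<Lambda>4: "\<Lambda> \<in> Vn V 4"
    unfolding \<Lambda> by (intro Vn_diff Vn_sc V4 V4')
  have "eb (Y V \<nu> (-1) \<nu> + sc V (- 3/10) (Y V \<nu> 0 (Y V \<nu> 0 \<nu>)))"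
    by (intro eb_add eb_sc eb_product[OF nu2 ebnu nu2 ebnu] eb_product[OF nu2 ebnu V3])
  then have eb\<Lambda>: "eb \<Lambda>" unfolding \<Lambda> by simp
  \<comment> \<open>The shifts 3 = 4 - 1 here and 1 = 2 - 1 for \<nu> turn product indices into
    modes, since \<Lambda> has degree 4 and \<nu> degree 2.\<close>
  obtain C p where C: "C \<ge> 0" "\<And>m n c. c \<in> Vn V n \<Longrightarrow> vnorm V (Y V \<Lambda> (m + 3) c) \<le> C * wt m n ^ p * vnorm V c"
    using eb_shiftE[OF eb\<Lambda>, of 3] by blast
  obtain D q where D: "D \<ge> 0" "\<And>m n c. c \<in> Vn V n \<Longrightarrow> vnorm V (Y V \<nu> (m + 1) c) \<le> D * wt m n ^ q * vnorm V c"
    using eb_shiftE[OF ebnu, of 1] by blast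
  define b where "b = \<bar>16 / (22 + 5 * c)\<bar>"
  show "eb \<mu>"
  proof (rule eb_hermitianI[OF mu(2,1,3)])
    show "\<bar>c\<bar> + (b * 2 * C + 2 * D) \<ge> 0" using C(1) D(1) by (simp add: b_def)
    fix m n :: int and v assume m: "m > 0" and n: "n \<ge> 0" and v: "v \<in> Vn V n"
    let ?w = "wt m n"
    have mw: "real_of_int m \<le> ?w" "0 \<le> real_of_int m" using m by (simp_all add: wt_def)
    have m2w: "(real_of_int m)\<^sup>2 \<le> ?w\<^sup>2" using mw by (intro power_mono) auto
    have w1: "1 \<le> ?w\<^sup>2" using one_le_power[OF wt_ge_1] .
    let ?x1 = "sc V (complex_of_real (c / (3 * 120) * real_of_int ((m^2 - 4) * (m^2 - 1) * m))) v"
    let ?x2 = "sc V (complex_of_real (16 / (22 + 5 * c) * real_of_int (2 * m))) (Y V \<Lambda> (0 + 3) v)"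
    let ?x3 = "sc V (complex_of_real (1/20 * real_of_int (2 * m * (5 * m^2 - 8)))) (Y V \<nu> (0 + 1) v)"
    have arith: "m + - m = 0" "m - - m = 2 * m" "2 * m\<^sup>2 - m * - m + 2 * (- m)\<^sup>2 - 8 = 5 * m\<^sup>2 - 8"
      "(0 :: int) + 4 - 1 = 0 + 3"
      by (simp_all add: power2_eq_square)
    have eq: "Y V \<mu> (m + 2) (Y V \<mu> (- m + 2) v) - Y V \<mu> (- m + 2) (Y V \<mu> (m + 2) v) = ?x1 + ?x2 + ?x3"
      using rel[of m "- m" v, folded \<Lambda>_def] by (simp only: arith mode_Vn[OF \<Lambda>4] simp_thms if_True mult_1_right)
    have "vnorm V (?x1 + ?x2 + ?x3) \<le> vnorm V ?x1 + (vnorm V ?x2 + vnorm V ?x3)"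
      by (rule vnorm_add3)
    \<comment> \<open>The powers 5, 1 and 3 are the degrees in m of the three coefficients; p and q
      come from \<Lambda> and \<nu>. The numerical factors 25/360 and 26/20 are rounded up to 1 and
      2.\<close>
    also have "\<dots> \<le> (\<bar>c\<bar> + (b * 2 * C + 2 * D)) * ?w ^ (5 + ((1 + p) + (3 + q))) * vnorm V v"
    proof (intro wt_bound_sum)
      have "\<bar>(real_of_int m)\<^sup>2 - 4\<bar> \<le> 5 * ?w\<^sup>2" "\<bar>(real_of_int m)\<^sup>2 - 1\<bar> \<le> 5 * ?w\<^sup>2"
        using m2w w1 zero_le_power2[of "real_of_int m"] by linarith+
      then have "\<bar>(real_of_int m)\<^sup>2 - 4\<bar> * \<bar>(real_of_int m)\<^sup>2 - 1\<bar> * \<bar>real_of_int m\<bar> \<le> (5 * ?w\<^sup>2) * (5 * ?w\<^sup>2) * ?w"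
        using mw by (intro mult_mono) auto
      then have "\<bar>real_of_int ((m^2 - 4) * (m^2 - 1) * m)\<bar> \<le> 25 * ?w ^ 5"
        by (simp add: abs_mult eval_nat_numeral mult_ac)
      then have "\<bar>c\<bar> / 360 * \<bar>real_of_int ((m^2 - 4) * (m^2 - 1) * m)\<bar> \<le> \<bar>c\<bar> / 360 * (25 * ?w ^ 5)"
        by (intro mult_left_mono) auto
      also have "\<dots> \<le> \<bar>c\<bar> * ?w ^ 5" by simp
      finally have "\<bar>c / (3 * 120) * real_of_int ((m^2 - 4) * (m^2 - 1) * m)\<bar> \<le> \<bar>c\<bar> * ?w ^ 5"
        by (simp only: abs_mult abs_divide)
      then show "vnorm V ?x1 \<le> \<bar>c\<bar> * ?w ^ 5 * vnorm V v"
        unfolding vnorm_sc norm_of_real by (rule mult_right_mono) simp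
      have "\<bar>16 / (22 + 5 * c) * real_of_int (2 * m)\<bar> \<le> b * (2 * ?w)"
        unfolding abs_mult b_def using mw by (intro mult_left_mono) auto
      moreover have "vnorm V (Y V \<Lambda> (0 + 3) v) \<le> C * ?w ^ p * vnorm V v"
        using C n m by (intro order.trans[OF C(2)[OF v]] mult_right_mono mult_left_mono wt_mono_abs) auto
      ultimately have "vnorm V ?x2 \<le> b * (2 * ?w) * (C * ?w ^ p * vnorm V v)"
        unfolding vnorm_sc norm_of_real by (intro mult_mono) (auto simp: b_def)
      then show "vnorm V ?x2 \<le> b * 2 * C * ?w ^ (1 + p) * vnorm V v"
        by (simp add: mult_ac)
      have "\<bar>5 * (real_of_int m)\<^sup>2 - 8\<bar> \<le> 13 * ?w\<^sup>2"
        using m2w w1 zero_le_power2[of "real_of_int m"] by linarith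
      then have "2 * real_of_int m * \<bar>5 * (real_of_int m)\<^sup>2 - 8\<bar> \<le> 2 * ?w * (13 * ?w\<^sup>2)"
        using mw by (intro mult_mono) auto
      then have "1/20 * (2 * real_of_int m * \<bar>5 * (real_of_int m)\<^sup>2 - 8\<bar>) \<le> 1/20 * (2 * ?w * (13 * ?w\<^sup>2))"
        by (rule mult_left_mono) simp
      also have "\<dots> \<le> 2 * ?w ^ 3"
        by (simp add: power3_eq_cube power2_eq_square)
      also have "1/20 * (2 * real_of_int m * \<bar>5 * (real_of_int m)\<^sup>2 - 8\<bar>)
          = \<bar>1/20 * real_of_int (2 * m * (5 * m^2 - 8))\<bar>"
        using mw by (simp add: abs_mult)
      finally have "\<bar>1/20 * real_of_int (2 * m * (5 * m^2 - 8))\<bar> \<le> 2 * ?w ^ 3" .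
      moreover have "vnorm V (Y V \<nu> (0 + 1) v) \<le> D * ?w ^ q * vnorm V v"
        using D n m by (intro order.trans[OF D(2)[OF v]] mult_right_mono mult_left_mono wt_mono_abs) auto
      ultimately have "vnorm V ?x3 \<le> 2 * ?w ^ 3 * (D * ?w ^ q * vnorm V v)"
        unfolding vnorm_sc norm_of_real by (intro mult_mono) auto
      then show "vnorm V ?x3 \<le> 2 * D * ?w ^ (3 + q) * vnorm V v"
        by (simp add: mult_ac power_add)
    qed (use C(1) D(1) in \<open>auto simp: b_def\<close>)
    finally have bound: "vnorm V (?x1 + ?x2 + ?x3) \<le> (\<bar>c\<bar> + (b * 2 * C + 2 * D)) * ?w ^ (5 + ((1 + p) + (3 + q))) * vnorm V v" .
    have idx: "m + 3 - 1 = m + 2" "- m + 3 - 1 = - m + 2" by simp_all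
    show "vnorm V (Y V \<mu> (m + 3 - 1) (Y V \<mu> (- m + 3 - 1) v) - Y V \<mu> (- m + 3 - 1) (Y V \<mu> (m + 3 - 1) v))
        \<le> (\<bar>c\<bar> + (b * 2 * C + 2 * D)) * ?w ^ (5 + ((1 + p) + (3 + q))) * vnorm V v"
      unfolding idx eq by (rule bound)
  qed simp
qed

end

section \<open>The generators lie in \<open>EB\<close>, hence so does the subalgebra they
  generate\<close>

theorem mainTheorem5:
  fixes V :: "('v::ab_group_add) uvoa" and U :: "'v set"
    and F :: "'v set" and G :: "'v set"
  assumes "simple_unitary_VOA V"
    and "unitary_subalgebra V U"
    and "\<forall>a\<in>F. hermitian V a \<and> quasi_primary V a \<and> (\<exists>c. virasoro_vector V a c)"
    and "\<forall>a\<in>G. \<exists>c. W3_vector V a c"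
    and "U = generated_subalgebra V ((U \<inter> Vn V 1) \<union> F \<union> G)"
  shows "energy_bounded_subalgebra V U"
proof -
  interpret uvoa V by unfold_locales fact
  have "(U \<inter> Vn V 1) \<union> F \<union> G \<subseteq> EB"
  proof (intro Un_least subsetI)
    fix a assume "a \<in> U \<inter> Vn V 1"
    then show "a \<in> EB" using EB_Vn eb_current by blast
  next
    fix a assume "a \<in> F"
    then show "a \<in> EB" using assms(3) EB_Vn[OF virasoro_V2 eb_virasoro] by blast
  next
    fix a assume "a \<in> G"
    then show "a \<in> EB" using assms(4) EB_Vn[OF eb_W3(2,1)] by blast
  qed
  then have "generated_subalgebra V ((U \<inter> Vn V 1) \<union> F \<union> G) \<subseteq> EB"
    using vertex_subalgebra_EB unfolding generated_subalgebra_def by blast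
  then have "U \<subseteq> EB" using assms(5) by simp
  then show ?thesis
    using assms(2) EB_energy_bounds unfolding energy_bounded_subalgebra_def by blast
qed

end
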